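(* Let $f\in C(E)$ and $x\in E\setminus E_0$. Then $$\lim_{T\to+\infty}\frac1T\int_0^T f(X_t)\,dt=\pi(f)\qquad\text{in }\mathbb P_x\text{ probability},$$ where $\pi$ is the probability on $E$ defined in the context and $\pi(f)=\int f\,d\pi$. Moreover, the convergence is uniform with respect to $x$ in a compact subset of $E\setminus E_0$, i.e. for every compact $E_1\subset E\setminus E_0$ and $\varepsilon>0$, $\sup_{x\in E_1}\mathbb P_x\big(\big|\frac1T\int_0^Tf(X_t)\,dt-\pi(f)\big|>\varepsilon\big)\to0$ as $T\to+\infty$.
   Context: Setting. $E$ is a compact Polish space with its Borel $\sigma$-algebra; $C(E)$, $C(E\times E)$ are the spaces of continuous functions. Consider the continuous time Markov chain on $E$ with transition rates $c(x,dy)=r(x)p(x,dy)$, where $r\colon E\to\mathbb R_+=[0,+\infty)$ and $p$ is a transition kernel on $E$ (in state $x$ the chain waits an exponential time of parameter $r(x)$, infinite if $r(x)=0$, then jumps according to $p(x,dy)$). $\mathbb P_x$ is its law with initial state $x$, a probability on the Skorokhod space $D(\mathbb R_+;E)$ with canonical coordinate $X_t$. Standing assumptions: (i) $r$ is continuous; set $E_0:=\{x\in E: r(x)=0\}$. (ii) There is a probability $\lambda$ on $E$, strictly positive on (nonempty) open sets, such that $p(x,dy)=p(x,y)\lambda(dy)$ for some strictly positive density $p\in C(E\times E)$. (iii) $\int\lambda(dx)\,1/r(x)<+\infty$. (iv) With $A_\delta:=\{x\in E: r(x)<\delta\}$, there is a sequence $\delta_n\to0$ ($\delta_n>0$) such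 that $\sup_n\lambda(A_{2\delta_n})/\lambda(A_{2\delta_n}\setminus A_{\delta_n})<+\infty$ (a condition the paper introduces for the large deviations lower bound). Invariant measure. By (ii) the discrete time chain with kernel $p$ is uniformly ergodic; $\pi_0$ denotes its unique invariant probability, and $\pi_0(1/r)<+\infty$. Then $\pi(dx):=\frac1{\pi_0(1/r)}\frac{\pi_0(dx)}{r(x)}$, a probability on $E$. *)

theory Defs
  imports "HOL-Probability.Probability"
begin

text \<open>
  The Skorokhod space of right-continuous paths with left limits. The Borel \<open>\<sigma>\<close>-algebra of the
  Skorokhod topology is the one generated by the coordinates, which is what is used here. Paths are
  extensional on the half-line, i.e. carry no information at negative times.
\<close>

definition cadlag_paths :: "(real \<Rightarrow> 'a::topological_space) set" where
  "cadlag_paths = {w \<in> extensional {0..}.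
     (\<forall>t\<ge>0. continuous (at_right t) w) \<and> (\<forall>t>0. \<exists>l. (w \<longlongrightarrow> l) (at_left t))}"

definition skorokhod_space :: "(real \<Rightarrow> 'a::topological_space) measure" where
  "skorokhod_space = restrict_space (PiM {0..} (\<lambda>_. borel)) cadlag_paths"

definition holding_law :: "real \<Rightarrow> ennreal measure" where
  "holding_law c = (if c = 0 then return borel \<infinity>
     else distr (density lborel (\<lambda>s. ennreal (exponential_density c s))) borel ennreal)"

text \<open>Draw a state from \<open>\<mu>\<close>, then the time spent there.\<close>

definition with_holding ::
    "('a::topological_space \<Rightarrow> real) \<Rightarrow> 'a measure \<Rightarrow> ('a \<times> ennreal) measure" where
  "with_holding r \<mu> = \<mu> \<bind> (\<lambda>y. distr (holding_law (r y)) (borel \<Otimes>\<^sub>M borel) (Pair y))"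

text \<open>
  Law of the sequence (visited state, holding time), by the Ionescu-Tulcea theorem. States are
  indexed by attempted jumps, since the kernel may charge the current state.
\<close>

definition skeleton_law ::
    "('a::topological_space \<Rightarrow> real) \<Rightarrow> ('a \<Rightarrow> 'a measure) \<Rightarrow> 'a \<Rightarrow> (nat \<Rightarrow> 'a \<times> ennreal) measure" where
  "skeleton_law r K x =
     (let M = (\<lambda>_. borel \<Otimes>\<^sub>M borel);
          P = (\<lambda>n w. with_holding r (if n = 0 then return borel x else K (fst (w (n - 1)))))
      in projective_family.lim UNIV (Ionescu_Tulcea.CI P M) M)"

definition jump_time :: "(nat \<Rightarrow> 'a \<times> ennreal) \<Rightarrow> nat \<Rightarrow> ennreal" where
  "jump_time w n = (\<Sum>k<n. snd (w k))"

text \<open>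
  At time \<open>t\<close> the path sits in the \<open>n\<close>-th state, where
  \<open>jump_time w n \<le> t < jump_time w (Suc n)\<close>. Explosive sequences, which form a null set for
  bounded rates, get a constant path so that every path is in the Skorokhod space.
\<close>

definition skeleton_path :: "(nat \<Rightarrow> 'a \<times> ennreal) \<Rightarrow> real \<Rightarrow> 'a" where
  "skeleton_path w = (\<lambda>t\<in>{0..}. if (SUP n. jump_time w n) = \<infinity>
     then fst (w (LEAST n. ennreal t < jump_time w (Suc n))) else fst (w 0))"

definition ctmc_law ::
    "('a::topological_space \<Rightarrow> real) \<Rightarrow> ('a \<Rightarrow> 'a measure) \<Rightarrow> 'a \<Rightarrow> (real \<Rightarrow> 'a) measure" where
  "ctmc_law r K x = distr (skeleton_law r K x) skorokhod_space skeleton_path"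

definition invariant_prob :: "('a::topological_space \<Rightarrow> 'a measure) \<Rightarrow> 'a measure \<Rightarrow> bool" where
  "invariant_prob K \<mu> \<longleftrightarrow> prob_space \<mu> \<and> sets \<mu> = sets borel \<and> \<mu> \<bind> K = \<mu>"

definition skeleton_invariant :: "('a::topological_space \<Rightarrow> 'a measure) \<Rightarrow> 'a measure" where
  "skeleton_invariant K = (THE \<mu>. invariant_prob K \<mu>)"

text \<open>Reciprocals of rates are taken in \<^typ>\<open>ennreal\<close>, where \<open>1 / 0 = \<infinity>\<close>.\<close>

definition ctmc_invariant ::
    "('a::topological_space \<Rightarrow> real) \<Rightarrow> ('a \<Rightarrow> 'a measure) \<Rightarrow> 'a measure" where
  "ctmc_invariant r K = (let \<pi>0 = skeleton_invariant K in
     density \<pi>0 (\<lambda>x. 1 / ennreal (r x) / (\<integral>\<^sup>+y. 1 / ennreal (r y) \<partial>\<pi>0)))"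

definition slow_set :: "('a \<Rightarrow> real) \<Rightarrow> real \<Rightarrow> 'a set" where
  "slow_set r d = {x. r x < d}"

definition time_average :: "('a \<Rightarrow> real) \<Rightarrow> real \<Rightarrow> (real \<Rightarrow> 'a) \<Rightarrow> real" where
  "time_average f T w = 1 / T * (LINT t:{0..T}|lborel. f (w t))"

text \<open>The law \<^const>\<open>ctmc_law\<close> is a genuine probability on the Skorokhod space.\<close>

lemma holding_law_measurable:
  assumes r[measurable]: "r \<in> borel_measurable M" and nn: "\<And>x. 0 \<le> r x"
  shows "(\<lambda>x. holding_law (r x)) \<in> M \<rightarrow>\<^sub>M prob_algebra borel"
proof (rule measurable_prob_algebraI)
  have ps: "prob_space (holding_law c)" if "0 \<le> c" for c
    using that prob_space_exponential_density[of c] unfolding holding_law_def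
    by (auto intro!: prob_space.prob_space_distr prob_space_return)
  then show "prob_space (holding_law (r x))" for x using nn by auto
  show "(\<lambda>x. holding_law (r x)) \<in> M \<rightarrow>\<^sub>M subprob_algebra borel"
  proof (rule measurable_subprob_algebra)
    fix a show "subprob_space (holding_law (r a))" by (intro prob_space_imp_subprob_space ps nn)
    show "sets (holding_law (r a)) = sets borel" by (simp add: holding_law_def)
  next
    fix A :: "ennreal set" assume A[measurable]: "A \<in> sets borel"
    have "(\<lambda>a. emeasure (holding_law (r a)) A) =
      (\<lambda>a. if r a = 0 then indicator A \<infinity> else
         \<integral>\<^sup>+s. ennreal (if s < 0 then 0 else r a * exp (- s * r a)) * indicator (ennreal -` A) s \<partial>lborel)"
    proof -
      have m: "ennreal -` A \<in> sets borel" using measurable_sets_borel[OF measurable_ennreal A] by simp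
      have m2: "(\<lambda>s. ennreal (exponential_density c s)) \<in> borel_measurable lborel" for c by simp
      show ?thesis
        unfolding fun_eq_iff
        using emeasure_density[OF m2, of "ennreal -` A"] m
        by (auto simp: holding_law_def emeasure_distr exponential_density_def simp del: emeasure_density)
    qed
    also have "\<dots> \<in> borel_measurable M" by measurable
    finally show "(\<lambda>a. emeasure (holding_law (r a)) A) \<in> borel_measurable M" .
  qed
qed

lemma with_holding_measurable:
  fixes r :: "'a::polish_space \<Rightarrow> real"
  assumes r[measurable]: "r \<in> borel_measurable borel" and nn: "\<And>x. 0 \<le> r x"
  and k[measurable]: "k \<in> M \<rightarrow>\<^sub>M prob_algebra borel"
  shows "(\<lambda>x. with_holding r (k x)) \<in> M \<rightarrow>\<^sub>M prob_algebra (borel \<Otimes>\<^sub>M borel)"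
proof -
  note [measurable] = holding_law_measurable[OF r nn]
  show ?thesis unfolding with_holding_def by measurable
qed

locale jump_kernel = 
  fixes r :: "'a::polish_space \<Rightarrow> real" and K :: "'a \<Rightarrow> 'a measure"
  assumes r[measurable]: "r \<in> borel_measurable borel" and nn: "\<And>x. 0 \<le> r x"
    and K[measurable]: "K \<in> borel \<rightarrow>\<^sub>M prob_algebra borel"
begin

abbreviation "step x \<equiv> (\<lambda>n w. with_holding r (if n = 0 then return borel x else K (fst (w (n - 1)))))"
abbreviation "M \<equiv> (\<lambda>_::nat. borel \<Otimes>\<^sub>M borel) :: nat \<Rightarrow> ('a \<times> ennreal) measure"

lemma Ionescu_Tulcea_step: "Ionescu_Tulcea (step x) M"
proof -
  have *: "step x i \<in> PiM {0..<i} M \<rightarrow>\<^sub>M prob_algebra (M i)" for i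
  proof (cases "i = 0")
    case True
    have "(\<lambda>_. return borel x) \<in> PiM {0..<i} M \<rightarrow>\<^sub>M prob_algebra borel" by measurable
    from with_holding_measurable[OF r nn this] True show ?thesis by simp
  next
    case False
    then have [measurable]: "(\<lambda>w. w (i - 1)) \<in> PiM {0..<i} M \<rightarrow>\<^sub>M (borel \<Otimes>\<^sub>M borel)"
      by (intro measurable_component_singleton) auto
    have "(\<lambda>w. K (fst (w (i - 1)))) \<in> PiM {0..<i} M \<rightarrow>\<^sub>M prob_algebra borel" by measurable
    from with_holding_measurable[OF r nn this] False show ?thesis by simp
  qed
  have pr: "prob_space (step x i w)" if "w \<in> space (PiM {0..<i} M)" for i w
    using measurable_space[OF * that] by (simp add: space_prob_algebra)
  show ?thesis
    by (rule Ionescu_Tulcea.intro) (rule measurable_prob_algebraD[OF *], rule pr)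
qed

sublocale IT: Ionescu_Tulcea "step x" M for x by (rule Ionescu_Tulcea_step)

lemma skeleton_law_eq: "skeleton_law r K x = IT.PF.lim x" by (simp add: skeleton_law_def Let_def)

lemma prob_space_skeleton_law: "prob_space (skeleton_law r K x)"
  unfolding skeleton_law_eq
proof 
  have "prob_space (distr (IT.PF.lim x) (PiM {} M) (\<lambda>w. restrict w {}))"
    using IT.PF.prob_space_P[of "{}" x] by (subst IT.distr_lim) auto
  then have "prob_space (IT.PF.lim x)"
    by (rule prob_space_distrD[rotated])
      (auto intro!: measurable_restrict simp: measurable_cong_sets[OF IT.PF.sets_lim refl])
  then show "emeasure (IT.PF.lim x) (space (IT.PF.lim x)) = 1" by (rule prob_space.emeasure_space_1)
qed

lemma sets_skeleton_law: "sets (skeleton_law r K x) = sets (PiM UNIV M)"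
  by (simp add: skeleton_law_eq)

end

lemma mono_jump_time: "mono (jump_time w)"
  by (rule monoI) (auto simp: jump_time_def intro!: sum_mono2)

lemma skeleton_path_eq:
  assumes s: "jump_time w n \<le> ennreal t" "ennreal t < jump_time w (Suc n)" "0 \<le> t"
    and inf: "(SUP n. jump_time w n) = \<infinity>"
  shows "skeleton_path w t = fst (w n)"
proof -
  have "(LEAST n. ennreal t < jump_time w (Suc n)) = n"
  proof (rule Least_equality)
    fix y assume y: "ennreal t < jump_time w (Suc y)"
    show "n \<le> y"
    proof (rule ccontr)
      assume "\<not> n \<le> y" then have "Suc y \<le> n" by simp
      from monoD[OF mono_jump_time this, of w] y s show False by (meson leD less_le_trans order_trans)
    qed
  qed (use s in auto)
  then show ?thesis using s inf by (simp add: skeleton_path_def)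
qed

lemma ex_jump_index:
  assumes inf: "(SUP n. jump_time w n) = \<infinity>"
  shows "\<exists>n. jump_time w n \<le> ennreal t \<and> ennreal t < jump_time w (Suc n)"
proof -
  have "\<exists>n. ennreal t < jump_time w n" using inf less_SUP_iff[of "ennreal t" "jump_time w" UNIV] by simp
  then have ex: "\<exists>n. ennreal t < jump_time w (Suc n)"
    by (meson mono_jump_time lessI less_imp_le less_le_trans monoD)
  define n where "n = (LEAST n. ennreal t < jump_time w (Suc n))"
  have 1: "ennreal t < jump_time w (Suc n)" unfolding n_def by (rule LeastI_ex[OF ex])
  have 2: "jump_time w n \<le> ennreal t"
  proof (cases n)
    case 0 then show ?thesis by (simp add: jump_time_def)
  next
    case (Suc m) then show ?thesis using not_less_Least[of m "\<lambda>n. ennreal t < jump_time w (Suc n)"]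
      unfolding n_def by simp
  qed
  show ?thesis using 1 2 by blast
qed

lemma skeleton_path_cadlag: "skeleton_path w \<in> cadlag_paths"
proof (cases "(SUP n. jump_time w n) = \<infinity>")
  case False
  have ev: "\<forall>\<^sub>F s in at_left t. s \<in> {0..}" if "0 < t" for t :: real
    using eventually_at_left_real[OF that] by eventually_elim auto
  have "(skeleton_path w \<longlongrightarrow> fst (w 0)) (at_right t)" if "0 \<le> t" for t
    using that False eventually_at_right_less[of t]
    by (intro tendsto_eventually) (auto simp: skeleton_path_def elim!: eventually_mono)
  moreover have "(skeleton_path w \<longlongrightarrow> fst (w 0)) (at_left t)" if "0 < t" for t
    using False ev[OF that]
    by (intro tendsto_eventually) (auto simp: skeleton_path_def elim!: eventually_mono)
  ultimately show ?thesis using False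
    by (auto simp: cadlag_paths_def skeleton_path_def continuous_within )
next
  case inf: True
  have R: "continuous (at_right t) (skeleton_path w)" if t: "0 \<le> t" for t
  proof -
    obtain n where n: "jump_time w n \<le> ennreal t" "ennreal t < jump_time w (Suc n)"
      using ex_jump_index[OF inf] by blast
    obtain b where b: "t < b" "ennreal b < jump_time w (Suc n)"
    proof (cases "jump_time w (Suc n)")
      case top then show ?thesis using that[of "t+1"] by simp
    next
      case (real a) 
      with n t have "t < a" by (simp add: ennreal_less_iff)
      then obtain b where "t < b" "b < a" using dense by blast
      then show ?thesis using that[of b] real t by (simp add: ennreal_less_iff)
    qed
    have "\<forall>\<^sub>F s in at_right t. skeleton_path w s = fst (w n)"
      using eventually_at_right_real[OF b(1)]
    proof eventually_elim
      case (elim s)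
      have "ennreal t \<le> ennreal s" "ennreal s \<le> ennreal b" using elim by (auto intro!: ennreal_leI)
      then show ?case using skeleton_path_eq[of w n s] inf n b t elim by (meson atLeastAtMost_iff greaterThanLessThan_iff le_less_trans less_imp_le order_trans)
    qed
    then show ?thesis using skeleton_path_eq[OF n t inf] by (simp add: continuous_within tendsto_eventually)
  qed
  have L: "\<exists>l. (skeleton_path w \<longlongrightarrow> l) (at_left t)" if t: "0 < t" for t
  proof -
    have ex: "\<exists>n. ennreal t \<le> jump_time w (Suc n)" using ex_jump_index[OF inf, of t] by (auto intro: less_imp_le)
    define n where "n = (LEAST n. ennreal t \<le> jump_time w (Suc n))"
    have 1: "ennreal t \<le> jump_time w (Suc n)" unfolding n_def by (rule LeastI_ex[OF ex])
    have 2: "jump_time w n < ennreal t"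
    proof (cases n)
      case 0 then show ?thesis using t by (simp add: jump_time_def)
    next
      case (Suc m) then show ?thesis using not_less_Least[of m "\<lambda>n. ennreal t \<le> jump_time w (Suc n)"]
        unfolding n_def by simp
    qed
    then obtain a where a: "jump_time w n = ennreal a" "0 \<le> a" "a < t"
      using t by (cases "jump_time w n") (auto simp: ennreal_less_iff)
    have "\<forall>\<^sub>F s in at_left t. skeleton_path w s = fst (w n)"
      using eventually_at_left_real[OF a(3)]
    proof eventually_elim
      case (elim s)
      then have "ennreal a \<le> ennreal s" "ennreal s < ennreal t" using a by (auto intro!: ennreal_leI simp: ennreal_less_iff)
      then show ?case using skeleton_path_eq[of w n s] inf 1 a elim by auto
    qed
    then show ?thesis by (auto intro: tendsto_eventually)
  qed
  show ?thesis using R L by (auto simp: cadlag_paths_def) (simp add: skeleton_path_def)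
qed

context jump_kernel begin

lemma skeleton_path_measurable: "skeleton_path \<in> skeleton_law r K x \<rightarrow>\<^sub>M skorokhod_space"
proof -
  have [measurable]: "(\<lambda>w. jump_time w n) \<in> borel_measurable (PiM UNIV M)" for n
    unfolding jump_time_def by measurable
  have [measurable]: "(\<lambda>w. fst (w (n::nat))) \<in> PiM UNIV M \<rightarrow>\<^sub>M borel" for n by measurable
  have [measurable]: "(\<lambda>w. LEAST n. ennreal t < jump_time w (Suc n)) \<in> PiM UNIV M \<rightarrow>\<^sub>M count_space UNIV" for t
    by measurable
  have "skeleton_path \<in> PiM UNIV M \<rightarrow>\<^sub>M PiM {0..} (\<lambda>_. borel)"
    unfolding skeleton_path_def[abs_def]
  proof (rule measurable_restrict)
    fix t :: real
    have [measurable]: "(\<lambda>w. fst (w (LEAST n. ennreal t < jump_time w (Suc n)))) \<in> PiM UNIV M \<rightarrow>\<^sub>M borel"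
      by (rule measurable_compose_countable[where f="\<lambda>n w. fst (w n)"]) measurable
    show "(\<lambda>w. if (SUP n. jump_time w n) = \<infinity>
     then fst (w (LEAST n. ennreal t < jump_time w (Suc n))) else fst (w 0)) \<in> PiM UNIV M \<rightarrow>\<^sub>M borel" by measurable
  qed
  then show ?thesis unfolding skorokhod_space_def
    using skeleton_path_cadlag by (auto intro!: measurable_restrict_space2 simp: measurable_cong_sets[OF sets_skeleton_law refl])
qed

lemma prob_space_ctmc_law: "prob_space (ctmc_law r K x)"
  unfolding ctmc_law_def by (intro prob_space.prob_space_distr prob_space_skeleton_law skeleton_path_measurable)

end

end

theory Submission
  imports Defs
begin

text \<open>
  The pairs (visited state, holding time) form a Markov chain whose kernel lies between two multiples
  of a fixed probability, because \<open>p\<close> is bounded above and below by positive constants. The lower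
  bound makes correlations decay geometrically, uniformly in the initial state, so averages of a
  bounded function of the pair have variance \<open>O(1/n)\<close>; the upper bound controls the error of
  truncating an integrable function. This gives a law of large numbers in mean for \<open>g(Y\<^sub>k) S\<^sub>k\<close>,
  where only the mean of the holding times \<open>S\<^sub>k\<close> is finite. Let \<open>m\<close> be the stationary mean of the
  holding time, \<open>h = f - \<pi>(f)\<close>, and take the deterministic index \<open>n = \<lfloor>T/m\<rfloor>\<close>. Then the integral
  of \<open>h\<close> along the path up to \<open>T\<close> differs from the sum of the \<open>h(Y\<^sub>k) S\<^sub>k\<close>, \<open>k < n\<close>, by at most
  \<open>sup |h|\<close> times the distance from \<open>T\<close> to the \<open>n\<close>-th jump time; both are \<open>o(T)\<close> in mean.
\<close>

section \<open>Doeblin kernels\<close>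

lemma (in prob_space)
  assumes [measurable]: "\<psi> \<in> borel_measurable M" and \<psi>: "\<psi> \<in> space M \<rightarrow> {a..b::real}"
  shows integrable_interval_valued: "integrable M \<psi>"
    and integral_in_interval: "(\<integral>x. \<psi> x \<partial>M) \<in> {a..b}"
proof -
  have bounds: "a \<le> \<psi> x" "\<psi> x \<le> b" if "x \<in> space M" for x
    using \<psi> that by (auto simp: Pi_iff)
  show "integrable M \<psi>"
    by (rule integrable_const_bound[where B="max \<bar>a\<bar> \<bar>b\<bar>"]) (use bounds in \<open>fastforce intro!: AE_I2\<close>)+
  then show "(\<integral>x. \<psi> x \<partial>M) \<in> {a..b}"
    using bounds by (auto intro!: integral_ge_const integral_le_const AE_I2)
qed

lemma
  fixes g :: "'a \<Rightarrow> ennreal"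
  assumes sets_eq: "sets \<mu> = sets \<nu>" and measurable: "g \<in> borel_measurable \<nu>"
  shows nn_integral_le_scale_measure: "\<mu> \<le> scale_measure a \<nu> \<Longrightarrow> (\<integral>\<^sup>+x. g x \<partial>\<mu>) \<le> a * (\<integral>\<^sup>+x. g x \<partial>\<nu>)"
    and scale_measure_le_nn_integral: "scale_measure a \<nu> \<le> \<mu> \<Longrightarrow> a * (\<integral>\<^sup>+x. g x \<partial>\<nu>) \<le> (\<integral>\<^sup>+x. g x \<partial>\<mu>)"
  using nn_integral_mono_measure[of \<mu> "scale_measure a \<nu>" g]
    nn_integral_mono_measure[of "scale_measure a \<nu>" \<mu> g]
  by (simp_all add: sets_eq nn_integral_scale_measure[OF measurable])

lemma
  fixes \<phi> :: "'a \<Rightarrow> real"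
  assumes sets_eq: "sets \<mu> = sets \<nu>" and dominated: "\<mu> \<le> scale_measure (ennreal C) \<nu>"
    and integrable: "integrable \<nu> \<phi>"
    and C_nonneg: "0 \<le> C"
  shows integrable_le_scale_measure: "integrable \<mu> \<phi>"
    and integral_abs_le_scale_measure: "(\<integral>x. \<bar>\<phi> x\<bar> \<partial>\<mu>) \<le> C * (\<integral>x. \<bar>\<phi> x\<bar> \<partial>\<nu>)"
proof -
  have measurable: "\<phi> \<in> borel_measurable \<nu>" using integrable by auto
  then have "(\<integral>\<^sup>+x. ennreal \<bar>\<phi> x\<bar> \<partial>\<mu>) \<le> ennreal C * (\<integral>\<^sup>+x. ennreal \<bar>\<phi> x\<bar> \<partial>\<nu>)"
    by (intro nn_integral_le_scale_measure[OF sets_eq _ dominated]) auto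
  also have "\<dots> = ennreal (C * (\<integral>x. \<bar>\<phi> x\<bar> \<partial>\<nu>))"
    using integrable C_nonneg by (simp add: nn_integral_eq_integral ennreal_mult)
  finally have nn_bound: "(\<integral>\<^sup>+x. ennreal \<bar>\<phi> x\<bar> \<partial>\<mu>) \<le> ennreal (C * (\<integral>x. \<bar>\<phi> x\<bar> \<partial>\<nu>))" .
  show "integrable \<mu> \<phi>"
    using measurable nn_bound by (intro integrableI_bounded)
      (auto simp: measurable_cong_sets[OF sets_eq refl] le_less_trans)
  then show "(\<integral>x. \<bar>\<phi> x\<bar> \<partial>\<mu>) \<le> C * (\<integral>x. \<bar>\<phi> x\<bar> \<partial>\<nu>)"
    using nn_bound C_nonneg by (simp add: nn_integral_eq_integral)
qed

locale markov_kernel =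
  fixes N :: "'z measure" and Q :: "'z \<Rightarrow> 'z measure"
  assumes kernel[measurable]: "Q \<in> N \<rightarrow>\<^sub>M prob_algebra N"
begin

lemma prob_kernel: "z \<in> space N \<Longrightarrow> prob_space (Q z)"
  and sets_kernel: "z \<in> space N \<Longrightarrow> sets (Q z) = sets N"
  using measurable_space[OF kernel] by (auto simp: space_prob_algebra)

lemma space_kernel: "z \<in> space N \<Longrightarrow> space (Q z) = space N"
  by (rule sets_eq_imp_space_eq[OF sets_kernel])

lemma subprob_kernel[measurable]: "Q \<in> N \<rightarrow>\<^sub>M subprob_algebra N"
  by (rule measurable_prob_algebraD[OF kernel])

definition transition_op :: "('z \<Rightarrow> real) \<Rightarrow> 'z \<Rightarrow> real" where
  "transition_op \<psi> z = (\<integral>y. \<psi> y \<partial>Q z)"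

lemma transition_op_measurable[measurable]:
  "\<psi> \<in> borel_measurable N \<Longrightarrow> transition_op \<psi> \<in> borel_measurable N"
  unfolding transition_op_def[abs_def]
  by (rule measurable_compose[OF subprob_kernel integral_measurable_subprob_algebra])

lemma
  assumes z_space: "z \<in> space N" and \<psi>: "\<psi> \<in> borel_measurable N" "\<psi> \<in> space N \<rightarrow> {a..b}"
  shows integrable_kernel: "integrable (Q z) \<psi>"
    and transition_op_interval: "transition_op \<psi> z \<in> {a..b}"
proof -
  interpret prob_space "Q z" by (rule prob_kernel[OF z_space])
  have "\<psi> \<in> borel_measurable (Q z)" "\<psi> \<in> space (Q z) \<rightarrow> {a..b}"
    using \<psi> z_space by (simp_all add: space_kernel measurable_cong_sets[OF sets_kernel refl])
  then show "integrable (Q z) \<psi>" "transition_op \<psi> z \<in> {a..b}"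
    unfolding transition_op_def by (rule integrable_interval_valued, rule integral_in_interval)
qed

lemma transition_op_iterate_measurable[measurable]:
  "\<psi> \<in> borel_measurable N \<Longrightarrow> (transition_op ^^ n) \<psi> \<in> borel_measurable N"
  by (induction n) auto

lemma transition_op_iterate_interval:
  assumes "\<psi> \<in> borel_measurable N" "\<psi> \<in> space N \<rightarrow> {a..b}"
  shows "(transition_op ^^ n) \<psi> \<in> space N \<rightarrow> {a..b}"
proof (induction n)
  case (Suc n)
  then show ?case
    using transition_op_interval[OF _ transition_op_iterate_measurable[OF assms(1)], of _ n a b]
    by auto
qed (use assms in auto)

definition invariant :: "'z measure \<Rightarrow> bool" where
  "invariant \<mu> \<longleftrightarrow> prob_space \<mu> \<and> sets \<mu> = sets N \<and> \<mu> \<bind> Q = \<mu>"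

lemma integral_transition_op:
  assumes "invariant \<mu>" and \<psi>[measurable]: "\<psi> \<in> borel_measurable N" "\<psi> \<in> space N \<rightarrow> {a..b}"
  shows "(\<integral>z. transition_op \<psi> z \<partial>\<mu>) = (\<integral>z. \<psi> z \<partial>\<mu>)"
proof -
  have \<mu>: "prob_space \<mu>" "sets \<mu> = sets N" "\<mu> \<bind> Q = \<mu>" using assms by (auto simp: invariant_def)
  interpret prob_space \<mu> by fact
  note [measurable_cong] = \<mu>(2)
  have "(\<integral>z. \<psi> z \<partial>(\<mu> \<bind> Q)) = (\<integral>z. transition_op \<psi> z \<partial>\<mu>)" unfolding transition_op_def
  proof (rule integral_bind[where K=N and B="max \<bar>a\<bar> \<bar>b\<bar>" and B'=1])
    show "\<bar>\<psi> z\<bar> \<le> max \<bar>a\<bar> \<bar>b\<bar>" if "z \<in> space N" for z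
      using \<psi>(2) that by (fastforce simp: Pi_iff)
    show "AE x in \<mu>. emeasure (Q x) (space (Q x)) \<le> ennreal 1"
      using prob_kernel
      by (auto intro!: AE_I2 simp: sets_eq_imp_space_eq[OF \<mu>(2)] prob_space.emeasure_space_1)
  qed (simp_all, measurable)
  then show ?thesis by (simp add: \<mu>)
qed

lemma integral_transition_op_iterate:
  assumes "invariant \<mu>" "\<psi> \<in> borel_measurable N" "\<psi> \<in> space N \<rightarrow> {a..b}"
  shows "(\<integral>z. (transition_op ^^ n) \<psi> z \<partial>\<mu>) = (\<integral>z. \<psi> z \<partial>\<mu>)"
proof (induction n)
  case (Suc n)
  then show ?case
    using integral_transition_op[OF assms(1) transition_op_iterate_measurable[OF assms(2)]
        transition_op_iterate_interval[OF assms(2,3)], of n] by simp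
qed simp

end

locale doeblin_kernel = markov_kernel N Q for N :: "'z measure" and Q +
  fixes \<nu> :: "'z measure" and c :: real
  assumes prob_\<nu>: "prob_space \<nu>"
    and sets_\<nu>[measurable_cong]: "sets \<nu> = sets N"
    and c_pos: "0 < c"
    and minorization: "z \<in> space N \<Longrightarrow> scale_measure (ennreal c) \<nu> \<le> Q z"
begin

lemma space_\<nu>: "space \<nu> = space N"
  by (rule sets_eq_imp_space_eq[OF sets_\<nu>])

lemma space_not_empty: "space N \<noteq> {}"
  using prob_space.not_empty[OF prob_\<nu>] by (simp add: space_\<nu>)

lemma emeasure_minorization: "z \<in> space N \<Longrightarrow> ennreal c * emeasure \<nu> A \<le> emeasure (Q z) A"
  using le_measureD3[OF minorization, of z A] by (simp add: sets_\<nu> sets_kernel)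

lemma c_le_1: "c \<le> 1"
proof -
  obtain z where "z \<in> space N" using space_not_empty by blast
  then show ?thesis
    using emeasure_minorization[of z "space N"] prob_space.emeasure_space_1[OF prob_kernel, of z]
      prob_space.emeasure_space_1[OF prob_\<nu>]
    by (simp add: space_\<nu> space_kernel)
qed

lemma integrable_minorizing:
  assumes [measurable]: "\<psi> \<in> borel_measurable N" and \<psi>: "\<psi> \<in> space N \<rightarrow> {a..b::real}"
  shows "integrable \<nu> \<psi>"
proof -
  interpret prob_space \<nu> by (rule prob_\<nu>)
  show ?thesis by (rule integrable_interval_valued) (use \<psi> in \<open>simp_all add: space_\<nu>\<close>)
qed

lemma integral_minorization:
  assumes z_space: "z \<in> space N" and [measurable]: "\<psi> \<in> borel_measurable N" and \<psi>: "\<psi> \<in> space N \<rightarrow> {0..b}"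
  shows "c * (\<integral>y. \<psi> y \<partial>\<nu>) \<le> transition_op \<psi> z"
proof -
  have integrable: "integrable \<nu> \<psi>" "integrable (Q z) \<psi>"
    by (rule integrable_minorizing[OF _ \<psi>] integrable_kernel[OF z_space _ \<psi>], measurable)+
  have nonneg: "AE y in \<nu>. 0 \<le> \<psi> y" "AE y in Q z. 0 \<le> \<psi> y"
    using \<psi> by (auto intro!: AE_I2 simp: space_\<nu> space_kernel[OF z_space] Pi_iff)
  have "ennreal c * (\<integral>\<^sup>+y. ennreal (\<psi> y) \<partial>\<nu>) \<le> (\<integral>\<^sup>+y. ennreal (\<psi> y) \<partial>Q z)"
    by (rule scale_measure_le_nn_integral[OF _ _ minorization[OF z_space]])
      (auto simp: sets_\<nu> sets_kernel z_space)
  then show ?thesis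
    using integrable nonneg c_pos integral_nonneg_AE[OF nonneg(1)] integral_nonneg_AE[OF nonneg(2)]
    by (simp add: transition_op_def nn_integral_eq_integral flip: ennreal_mult)
qed

lemma transition_op_contracts_oscillation:
  assumes [measurable]: "\<psi> \<in> borel_measurable N" and \<psi>: "\<psi> \<in> space N \<rightarrow> {a..a + d}"
  shows "\<exists>a'. transition_op \<psi> \<in> space N \<rightarrow> {a'..a' + (1 - c) * d}"
proof (rule exI[of _ "a + c * ((\<integral>y. \<psi> y \<partial>\<nu>) - a)"], rule funcsetI)
  fix z assume z_space: "z \<in> space N"
  interpret \<nu>: prob_space \<nu> by (rule prob_\<nu>)
  interpret Qz: prob_space "Q z" by (rule prob_kernel[OF z_space])
  have integrable: "integrable \<nu> \<psi>" "integrable (Q z) \<psi>"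
    by (rule integrable_minorizing[OF _ \<psi>] integrable_kernel[OF z_space _ \<psi>], measurable)+
  have "c * (\<integral>y. \<psi> y - a \<partial>\<nu>) \<le> transition_op (\<lambda>y. \<psi> y - a) z"
    by (rule integral_minorization[OF z_space, where b=d]) (use \<psi> in \<open>auto simp: Pi_iff algebra_simps\<close>)
  moreover have "c * (\<integral>y. a + d - \<psi> y \<partial>\<nu>) \<le> transition_op (\<lambda>y. a + d - \<psi> y) z"
    by (rule integral_minorization[OF z_space, where b=d]) (use \<psi> in \<open>auto simp: Pi_iff algebra_simps\<close>)
  ultimately show "transition_op \<psi> z \<in> {a + c * ((\<integral>y. \<psi> y \<partial>\<nu>) - a)..a + c * ((\<integral>y. \<psi> y \<partial>\<nu>) - a)
        + (1 - c) * d}"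
    using integrable by (simp add: transition_op_def \<nu>.prob_space Qz.prob_space algebra_simps)
qed

lemma transition_op_iterate_oscillation:
  assumes "\<psi> \<in> borel_measurable N" "\<psi> \<in> space N \<rightarrow> {a..a + d}"
  shows "\<exists>a'. (transition_op ^^ n) \<psi> \<in> space N \<rightarrow> {a'..a' + (1 - c) ^ n * d}"
proof (induction n)
  case (Suc n)
  then show ?case
    using transition_op_contracts_oscillation[OF transition_op_iterate_measurable[OF assms(1)], of n]
    by (auto simp: mult.assoc)
qed (use assms in auto)

lemma geometric_ergodicity:
  assumes \<mu>: "invariant \<mu>" and [measurable]: "\<psi> \<in> borel_measurable N" and \<psi>: "\<psi> \<in> space N \<rightarrow> {a..a + d}"
    and z_space: "z \<in> space N"
  shows "\<bar>(transition_op ^^ n) \<psi> z - (\<integral>y. \<psi> y \<partial>\<mu>)\<bar> \<le> (1 - c) ^ n * d"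
proof -
  have "prob_space \<mu>" and sets_\<mu>[measurable_cong]: "sets \<mu> = sets N"
    using \<mu> by (auto simp: invariant_def)
  then interpret prob_space \<mu> by simp
  obtain a' where oscillation: "(transition_op ^^ n) \<psi> \<in> space N \<rightarrow> {a'..a' + (1 - c) ^ n * d}"
    using transition_op_iterate_oscillation[OF _ \<psi>] by auto
  then have "(\<integral>y. (transition_op ^^ n) \<psi> y \<partial>\<mu>) \<in> {a'..a' + (1 - c) ^ n * d}"
    by (intro integral_in_interval) (auto simp: sets_eq_imp_space_eq[OF sets_\<mu>])
  moreover have "(transition_op ^^ n) \<psi> z \<in> {a'..a' + (1 - c) ^ n * d}" using oscillation z_space by auto
  ultimately show ?thesis
    using integral_transition_op_iterate[OF \<mu> _ \<psi>, of n] by (auto simp: abs_le_iff)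
qed

lemma invariant_unique:
  assumes \<mu>: "invariant \<mu>" and \<mu>': "invariant \<mu>'"
  shows "\<mu> = \<mu>'"
proof (rule measure_eqI)
  show "sets \<mu> = sets \<mu>'" using \<mu> \<mu>' by (simp add: invariant_def)
  fix A assume "A \<in> sets \<mu>"
  then have A_sets[measurable]: "A \<in> sets N" using \<mu> by (simp add: invariant_def)
  obtain z where z_space: "z \<in> space N" using space_not_empty by blast
  have iterates_lim: "(\<lambda>n. (transition_op ^^ n) (indicator A) z) \<longlonglongrightarrow> measure \<rho> A" if \<rho>: "invariant \<rho>" for \<rho>
  proof -
    have "(\<integral>y. indicator A y \<partial>\<rho>) = measure \<rho> A"
      using \<rho> sets.sets_into_space[OF A_sets] sets_eq_imp_space_eq[of \<rho> N]
      by (simp add: invariant_def Int_absorb2)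
    then have deviation: "norm ((transition_op ^^ n) (indicator A) z - measure \<rho> A) \<le> (1 - c) ^ n" for n
      using geometric_ergodicity[OF \<rho> _ _ z_space, of "indicator A" 0 1 n] by (simp add: indicator_def)
    have "(\<lambda>n. (1 - c) ^ n) \<longlonglongrightarrow> 0" using c_le_1 c_pos by (intro LIMSEQ_power_zero) auto
    then show ?thesis
      by (rule LIM_zero_cancel[OF Lim_null_comparison[OF always_eventually[OF allI[OF deviation]]]])
  qed
  have "measure \<mu> A = measure \<mu>' A" by (rule LIMSEQ_unique[OF iterates_lim[OF \<mu>] iterates_lim[OF \<mu>']])
  then show "emeasure \<mu> A = emeasure \<mu>' A"
    using \<mu> \<mu>' by (simp add: invariant_def finite_measure.emeasure_eq_measure prob_space.finite_measure)
qed

definition residual_kernel :: "'z \<Rightarrow> 'z measure" where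
  "residual_kernel z = diff_measure (Q z) (scale_measure (ennreal c) \<nu>)"

lemma sets_residual_kernel: "z \<in> space N \<Longrightarrow> sets (residual_kernel z) = sets N"
  by (simp add: residual_kernel_def sets_kernel)

lemma emeasure_residual_kernel:
  assumes z_space: "z \<in> space N" and A_sets: "A \<in> sets N"
  shows "emeasure (residual_kernel z) A = emeasure (Q z) A - ennreal c * emeasure \<nu> A"
proof -
  have "finite_measure (scale_measure (ennreal c) \<nu>)"
    by (rule finite_measureI)
      (simp add: space_scale_measure prob_space.emeasure_space_1[OF prob_\<nu>])
  then show ?thesis
    unfolding residual_kernel_def
    using z_space A_sets emeasure_minorization prob_space.finite_measure[OF prob_kernel[OF z_space]]
    by (subst emeasure_diff_measure) (auto simp: sets_\<nu> sets_kernel)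
qed

lemma kernel_decomposition:
  assumes "z \<in> space N" "A \<in> sets N"
  shows "emeasure (Q z) A = ennreal c * emeasure \<nu> A + emeasure (residual_kernel z) A"
  using emeasure_minorization[OF assms(1)] assms
  by (simp add: emeasure_residual_kernel add_diff_inverse_ennreal)

lemma emeasure_residual_kernel_space:
  assumes z_space: "z \<in> space N" shows "emeasure (residual_kernel z) (space N) = ennreal (1 - c)"
  using prob_space.emeasure_space_1[OF prob_kernel[OF z_space]] prob_space.emeasure_space_1[OF prob_\<nu>]
    ennreal_minus[of c 1] c_pos
  by (simp add: emeasure_residual_kernel z_space space_\<nu> space_kernel)

lemma residual_kernel_measurable[measurable]: "residual_kernel \<in> N \<rightarrow>\<^sub>M subprob_algebra N"
proof (rule measurable_subprob_algebra)
  show "subprob_space (residual_kernel z)" if z_space: "z \<in> space N" for z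
    using emeasure_residual_kernel_space[OF z_space] c_pos z_space space_not_empty
      sets_eq_imp_space_eq[OF sets_residual_kernel[OF z_space]]
    by (intro subprob_spaceI) auto
  fix A assume A_sets[measurable]: "A \<in> sets N"
  have "(\<lambda>z. emeasure (Q z) A - ennreal c * emeasure \<nu> A) \<in> borel_measurable N" by measurable
  then show "(\<lambda>z. emeasure (residual_kernel z) A) \<in> borel_measurable N"
    by (rule measurable_cong[THEN iffD1, rotated]) (simp add: emeasure_residual_kernel)
qed (rule sets_residual_kernel)

text \<open>Decomposing \<open>Q\<close> along the last regeneration gives the invariant probability as the
  geometric series \<open>c \<Sum>\<^sub>k \<nu> R\<^sup>k\<close>, where \<open>R = Q - c \<nu>\<close>.\<close>

primrec unregenerated_law :: "nat \<Rightarrow> 'z measure" where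
  "unregenerated_law 0 = \<nu>"
| "unregenerated_law (Suc k) = unregenerated_law k \<bind> residual_kernel"

definition regeneration_law :: "'z measure" where
  "regeneration_law = scale_measure (ennreal c) (count_space UNIV \<bind> unregenerated_law)"

lemma unregenerated_law_subprob: "unregenerated_law k \<in> space (subprob_algebra N)"
proof (induction k)
  case 0
  then show ?case
    by (simp add: space_subprob_algebra sets_\<nu> prob_space_imp_subprob_space prob_\<nu>)
next
  case (Suc k)
  note measurable_bind2[OF measurable_ident_sets[OF refl] residual_kernel_measurable]
  from measurable_space[OF this Suc]
  show ?case by simp
qed

lemma sets_unregenerated_law[measurable_cong]: "sets (unregenerated_law k) = sets N"
  using unregenerated_law_subprob by (simp add: space_subprob_algebra)

lemma space_unregenerated_law: "space (unregenerated_law k) = space N"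
  by (rule sets_eq_imp_space_eq[OF sets_unregenerated_law])

lemma emeasure_unregenerated_law_Suc:
  assumes "A \<in> sets N"
  shows "emeasure (unregenerated_law (Suc k)) A
      = (\<integral>\<^sup>+z. emeasure (residual_kernel z) A \<partial>unregenerated_law k)"
  using emeasure_bind[OF _ _ assms, of "unregenerated_law k" residual_kernel] space_not_empty
  by (simp add: space_unregenerated_law)

lemma emeasure_unregenerated_law_space:
  "emeasure (unregenerated_law k) (space N) = ennreal ((1 - c) ^ k)"
proof (induction k)
  case 0
  show ?case using prob_space.emeasure_space_1[OF prob_\<nu>] by (simp add: space_\<nu>)
next
  case (Suc k)
  have "emeasure (unregenerated_law (Suc k)) (space N) = (\<integral>\<^sup>+z. ennreal (1 - c) \<partial>unregenerated_law k)"
    unfolding emeasure_unregenerated_law_Suc[OF sets.top]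
    by (intro nn_integral_cong) (simp add: space_unregenerated_law emeasure_residual_kernel_space)
  then show ?case
    using Suc c_le_1 by (simp add: space_unregenerated_law ennreal_mult del: unregenerated_law.simps)
qed

lemma sets_regeneration_law[measurable_cong]: "sets regeneration_law = sets N"
  using sets_unregenerated_law by (simp add: regeneration_law_def sets_bind[where N=N])

lemma nn_integral_regeneration_law:
  assumes [measurable]: "g \<in> borel_measurable N"
  shows "(\<integral>\<^sup>+z. g z \<partial>regeneration_law) = ennreal c * (\<Sum>k. \<integral>\<^sup>+z. g z \<partial>unregenerated_law k)"
proof -
  have [measurable]: "unregenerated_law \<in> count_space UNIV \<rightarrow>\<^sub>M subprob_algebra N"
    using unregenerated_law_subprob by simp
  have [measurable_cong]: "sets (count_space UNIV \<bind> unregenerated_law) = sets N"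
    using sets_unregenerated_law by (simp add: sets_bind[where N=N])
  have "(\<integral>\<^sup>+z. g z \<partial>regeneration_law) = ennreal c * (\<integral>\<^sup>+z. g z \<partial>(count_space UNIV \<bind> unregenerated_law))"
    unfolding regeneration_law_def by (rule nn_integral_scale_measure) measurable
  also have "(\<integral>\<^sup>+z. g z \<partial>(count_space UNIV \<bind> unregenerated_law))
      = (\<integral>\<^sup>+k. \<integral>\<^sup>+z. g z \<partial>unregenerated_law k \<partial>count_space UNIV)"
    by (rule nn_integral_bind) measurable
  finally show ?thesis by (simp add: nn_integral_count_space_nat)
qed

lemma emeasure_regeneration_law:
  "A \<in> sets N \<Longrightarrow> emeasure regeneration_law A = ennreal c * (\<Sum>k. emeasure (unregenerated_law k) A)"
  using nn_integral_regeneration_law[of "indicator A"]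
  by (simp add: sets_regeneration_law sets_unregenerated_law)

lemma prob_regeneration_law: "prob_space regeneration_law"
proof
  have "(\<Sum>k. ennreal ((1 - c) ^ k)) = ennreal (1 / c)"
    using c_pos c_le_1 by (subst suminf_ennreal2) (auto simp: summable_geometric suminf_geometric)
  then show "emeasure regeneration_law (space regeneration_law) = 1"
    using c_pos
    by (simp add: sets_eq_imp_space_eq[OF sets_regeneration_law] emeasure_regeneration_law
        emeasure_unregenerated_law_space flip: ennreal_mult)
qed

lemma regeneration_law_bind_kernel: "regeneration_law \<bind> Q = regeneration_law"
proof (rule measure_eqI)
  have not_empty: "space regeneration_law \<noteq> {}" by (rule prob_space.not_empty[OF prob_regeneration_law])
  show sets_eq: "sets (regeneration_law \<bind> Q) = sets regeneration_law"
    using not_empty sets_kernel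
    by (subst sets_bind[where N=N])
      (auto simp: sets_regeneration_law sets_eq_imp_space_eq[OF sets_regeneration_law])
  fix A assume "A \<in> sets (regeneration_law \<bind> Q)"
  then have A_sets[measurable]: "A \<in> sets N" by (simp add: sets_eq sets_regeneration_law)
  have "(\<integral>\<^sup>+z. emeasure (Q z) A \<partial>unregenerated_law k)
      = ennreal c * emeasure \<nu> A * emeasure (unregenerated_law k) (space N)
        + emeasure (unregenerated_law (Suc k)) A" for k
  proof -
    have "(\<integral>\<^sup>+z. emeasure (Q z) A \<partial>unregenerated_law k)
        = (\<integral>\<^sup>+z. ennreal c * emeasure \<nu> A + emeasure (residual_kernel z) A \<partial>unregenerated_law k)"
      by (intro nn_integral_cong) (simp add: kernel_decomposition A_sets space_unregenerated_law)
    then show ?thesis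
      by (simp add: nn_integral_add emeasure_unregenerated_law_Suc[OF A_sets] space_unregenerated_law
        del: unregenerated_law.simps)
  qed
  then have "emeasure (regeneration_law \<bind> Q) A
      = ennreal c * (emeasure \<nu> A * (ennreal c * (\<Sum>k. emeasure (unregenerated_law k) (space N)))
        + (\<Sum>k. emeasure (unregenerated_law (Suc k)) A))"
    using not_empty
    by (simp add: emeasure_bind[where N=N] nn_integral_regeneration_law suminf_add[symmetric] mult_ac
        del: unregenerated_law.simps)
  also have "ennreal c * (\<Sum>k. emeasure (unregenerated_law k) (space N)) = 1"
    using prob_space.emeasure_space_1[OF prob_regeneration_law]
    by (simp add: emeasure_regeneration_law sets_eq_imp_space_eq[OF sets_regeneration_law])
  also have "emeasure \<nu> A * 1 + (\<Sum>k. emeasure (unregenerated_law (Suc k)) A)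
      = (\<Sum>k. emeasure (unregenerated_law k) A)"
    using suminf_offset[of "\<lambda>k. emeasure (unregenerated_law k) A" 1] by simp
  finally show "emeasure (regeneration_law \<bind> Q) A = emeasure regeneration_law A"
    by (simp add: emeasure_regeneration_law)
qed

theorem ex1_invariant: "\<exists>!\<mu>. invariant \<mu>"
  using prob_regeneration_law sets_regeneration_law regeneration_law_bind_kernel invariant_unique
  by (intro ex1I[of _ regeneration_law]) (auto simp: invariant_def)

end

section \<open>A weak law of large numbers in mean\<close>

lemma (in prob_space) expectation_abs_le_sqrt:
  assumes [measurable]: "random_variable borel f" and "integrable M (\<lambda>x. (f x)\<^sup>2 :: real)"
  shows "expectation (\<lambda>x. \<bar>f x\<bar>) \<le> sqrt (expectation (\<lambda>x. (f x)\<^sup>2))"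
proof -
  have "integrable M f" by (rule square_integrable_imp_integrable) (use assms in auto)
  then have "0 \<le> expectation (\<lambda>x. (f x)\<^sup>2) - (expectation (\<lambda>x. \<bar>f x\<bar>))\<^sup>2"
    using variance_positive[of "\<lambda>x. \<bar>f x\<bar>"] assms(2) by (simp add: variance_eq)
  then show ?thesis by (intro real_le_rsqrt) simp
qed

lemma (in markov_kernel) joint_kernel_measurable:
  "(\<lambda>(y, z). distr (Q z) (N \<Otimes>\<^sub>M N) (Pair y)) \<in> N \<Otimes>\<^sub>M N \<rightarrow>\<^sub>M subprob_algebra (N \<Otimes>\<^sub>M N)"
  unfolding case_prod_unfold by (rule measurable_distr2[where M=N]) measurable

text \<open>Only laws of pairs are prescribed: second moments need no more of the Markov property.\<close>

locale markov_chain = markov_kernel N Q + prob_space P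
  for N :: "'z measure" and Q and P :: "'w measure" +
  fixes X :: "nat \<Rightarrow> 'w \<Rightarrow> 'z"
  assumes X_measurable[measurable]: "X n \<in> P \<rightarrow>\<^sub>M N"
    and markov: "i \<le> n \<Longrightarrow> distr P (N \<Otimes>\<^sub>M N) (\<lambda>w. (X i w, X (Suc n) w))
      = distr P (N \<Otimes>\<^sub>M N) (\<lambda>w. (X i w, X n w)) \<bind> (\<lambda>(y, z). distr (Q z) (N \<Otimes>\<^sub>M N) (Pair y))"
begin

lemma X_in_space: "w \<in> space P \<Longrightarrow> X n w \<in> space N"
  by (rule measurable_space[OF X_measurable])

lemma distr_pair_eq_bind:
  assumes "i \<le> n"
  shows "distr P (N \<Otimes>\<^sub>M N) (\<lambda>w. (X i w, X (Suc n) w))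
      = P \<bind> (\<lambda>w. distr (Q (X n w)) (N \<Otimes>\<^sub>M N) (Pair (X i w)))"
  unfolding markov[OF assms] using joint_kernel_measurable
  by (subst bind_distr[where K="N \<Otimes>\<^sub>M N"]) (auto simp: not_empty)

lemma pair_kernel_measurable[measurable]:
  "(\<lambda>w. distr (Q (X n w)) (N \<Otimes>\<^sub>M N) (Pair (X i w))) \<in> P \<rightarrow>\<^sub>M prob_algebra (N \<Otimes>\<^sub>M N)"
  by measurable

lemma distr_Suc: "distr P N (X (Suc n)) = distr P N (X n) \<bind> Q"
proof -
  have "distr P N (X (Suc n)) = distr (distr P (N \<Otimes>\<^sub>M N) (\<lambda>w. (X n w, X (Suc n) w))) N snd"
    by (simp add: distr_distr comp_def)
  also have "\<dots> = P \<bind> (\<lambda>w. distr (distr (Q (X n w)) (N \<Otimes>\<^sub>M N) (Pair (X n w))) N snd)"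
    unfolding distr_pair_eq_bind[OF order_refl]
    by (intro distr_bind[where K="N \<Otimes>\<^sub>M N"] measurable_prob_algebraD[OF pair_kernel_measurable])
      (auto simp: not_empty)
  also have "\<dots> = P \<bind> (\<lambda>w. Q (X n w))"
  proof (rule bind_cong[OF refl])
    fix w assume w: "w \<in> space P"
    have "distr (distr (Q (X n w)) (N \<Otimes>\<^sub>M N) (Pair (X n w))) N snd = distr (Q (X n w)) N (\<lambda>z. z)"
      using X_in_space[OF w]
      by (subst distr_distr) (auto simp: comp_def measurable_cong_sets[OF sets_kernel refl])
    then show "distr (distr (Q (X n w)) (N \<Otimes>\<^sub>M N) (Pair (X n w))) N snd = Q (X n w)"
      using sets_kernel[OF X_in_space[OF w]] by (simp add: distr_id2)
  qed
  also have "\<dots> = distr P N (X n) \<bind> Q"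
    by (rule bind_distr[symmetric, OF X_measurable subprob_kernel not_empty])
  finally show ?thesis .
qed

lemma expectation_transition:
  fixes f g :: "'z \<Rightarrow> real"
  assumes [measurable]: "f \<in> borel_measurable N" "g \<in> borel_measurable N"
    and f_interval: "f \<in> space N \<rightarrow> {-a..a}" and g_interval: "g \<in> space N \<rightarrow> {-b..b}" and "i \<le> n"
  shows "expectation (\<lambda>w. f (X i w) * g (X (Suc n) w))
      = expectation (\<lambda>w. f (X i w) * transition_op g (X n w))"
proof -
  let ?F = "\<lambda>p. f (fst p) * g (snd p)"
  let ?\<kappa> = "\<lambda>w. distr (Q (X n w)) (N \<Otimes>\<^sub>M N) (Pair (X i w))"
  have F_bounded: "\<bar>?F p\<bar> \<le> a * b" if "p \<in> space (N \<Otimes>\<^sub>M N)" for p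
  proof -
    have "\<bar>f (fst p)\<bar> \<le> a" "\<bar>g (snd p)\<bar> \<le> b"
      using that f_interval g_interval by (auto simp: space_pair_measure abs_le_iff minus_le_iff Pi_iff)
    then show ?thesis unfolding abs_mult by (intro mult_mono) auto
  qed
  have "expectation (\<lambda>w. f (X i w) * g (X (Suc n) w)) = (\<integral>p. ?F p \<partial>(P \<bind> ?\<kappa>))"
    by (subst distr_pair_eq_bind[OF \<open>i \<le> n\<close>, symmetric], subst integral_distr) auto
  also have "\<dots> = expectation (\<lambda>w. \<integral>p. ?F p \<partial>?\<kappa> w)"
  proof (rule integral_bind[where K="N \<Otimes>\<^sub>M N" and B="a * b" and B'=1])
    show "AE w in P. emeasure (?\<kappa> w) (space (?\<kappa> w)) \<le> ennreal 1"
      using measurable_space[OF pair_kernel_measurable, of _ n i]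
      by (intro AE_I2) (simp add: space_prob_algebra prob_space.emeasure_space_1 del: space_distr)
    show "?\<kappa> \<in> P \<rightarrow>\<^sub>M subprob_algebra (N \<Otimes>\<^sub>M N)"
      by (rule measurable_prob_algebraD[OF pair_kernel_measurable])
  qed (simp_all add: F_bounded finite_measure_axioms)
  also have "\<dots> = expectation (\<lambda>w. f (X i w) * transition_op g (X n w))"
  proof (rule Bochner_Integration.integral_cong[OF refl])
    fix w assume "w \<in> space P"
    then have "X i w \<in> space N" "X n w \<in> space N" by (simp_all add: X_in_space)
    then show "(\<integral>p. ?F p \<partial>?\<kappa> w) = f (X i w) * transition_op g (X n w)"
      by (subst integral_distr) (auto simp: transition_op_def measurable_cong_sets[OF sets_kernel refl])
  qed
  finally show ?thesis .
qed

lemma expectation_transition_iterate: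
  fixes f g :: "'z \<Rightarrow> real"
  assumes [measurable]: "f \<in> borel_measurable N" "g \<in> borel_measurable N"
    and f_interval: "f \<in> space N \<rightarrow> {-a..a}" and g_interval: "g \<in> space N \<rightarrow> {-b..b}"
  shows "expectation (\<lambda>w. f (X i w) * g (X (i + k) w))
      = expectation (\<lambda>w. f (X i w) * (transition_op ^^ k) g (X i w))"
  using assms(2) g_interval
proof (induction k arbitrary: g)
  case (Suc k)
  have "expectation (\<lambda>w. f (X i w) * g (X (i + Suc k) w))
      = expectation (\<lambda>w. f (X i w) * transition_op g (X (i + k) w))"
    using expectation_transition[OF _ Suc.prems(1) f_interval Suc.prems(2), of i "i + k"] by simp
  also have "\<dots> = expectation (\<lambda>w. f (X i w) * (transition_op ^^ k) (transition_op g) (X i w))"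
    using transition_op_interval[OF _ Suc.prems] Suc.prems(1) by (intro Suc.IH) auto
  finally show ?case by (simp add: funpow_swap1)
qed simp

end

locale doeblin_chain = doeblin_kernel N Q \<nu> c + markov_chain N Q P X
  for N :: "'z measure" and Q \<nu> c and P :: "'w measure" and X
begin

lemma centered_correlation_le:
  assumes \<mu>: "invariant \<mu>" and [measurable]: "\<phi> \<in> borel_measurable N" and \<phi>: "\<phi> \<in> space N \<rightarrow> {-b..b}"
    and centered: "(\<integral>z. \<phi> z \<partial>\<mu>) = 0"
  shows "expectation (\<lambda>w. \<phi> (X i w) * \<phi> (X (i + k) w)) \<le> 2 * b\<^sup>2 * (1 - c) ^ k"
proof -
  have \<phi>_le: "\<bar>\<phi> z\<bar> \<le> b" if "z \<in> space N" for z
    using \<phi> that by (auto simp: abs_le_iff minus_le_iff Pi_iff)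
  have bound: "\<bar>\<phi> (X i w) * (transition_op ^^ k) \<phi> (X i w)\<bar>
      \<le> 2 * b\<^sup>2 * (1 - c) ^ k" if "w \<in> space P" for w
  proof -
    have "\<bar>(transition_op ^^ k) \<phi> (X i w)\<bar> \<le> (1 - c) ^ k * (2 * b)"
      using geometric_ergodicity[OF \<mu>, of \<phi> "-b" "2 * b" "X i w" k] \<phi> that
      by (simp add: centered X_in_space)
    then have "\<bar>\<phi> (X i w)\<bar> * \<bar>(transition_op ^^ k) \<phi> (X i w)\<bar> \<le> b * ((1 - c) ^ k * (2 * b))"
      using \<phi>_le[OF X_in_space[OF that]] by (intro mult_mono) (auto intro: order_trans[OF abs_ge_zero])
    then show ?thesis by (simp add: abs_mult power2_eq_square mult_ac)
  qed
  have "expectation (\<lambda>w. \<phi> (X i w) * \<phi> (X (i + k) w))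
      = expectation (\<lambda>w. \<phi> (X i w) * (transition_op ^^ k) \<phi> (X i w))"
    by (rule expectation_transition_iterate) (use \<phi> in auto)
  also have "\<dots> \<le> 2 * b\<^sup>2 * (1 - c) ^ k"
    using bound
    by (intro integral_le_const integrable_const_bound[where B="2 * b\<^sup>2 * (1 - c) ^ k"] AE_I2)
      (auto simp: abs_le_iff)
  finally show ?thesis .
qed

lemma sum_centered_correlation_le:
  assumes \<mu>: "invariant \<mu>" and "\<phi> \<in> borel_measurable N" and \<phi>: "\<phi> \<in> space N \<rightarrow> {-b..b}"
    and centered: "(\<integral>z. \<phi> z \<partial>\<mu>) = 0"
  shows "(\<Sum>k<n. expectation (\<lambda>w. \<phi> (X k w) * \<phi> (X n w))) \<le> 2 * b\<^sup>2 * ((1 - c) / c)"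
proof -
  have "(\<Sum>k<n. expectation (\<lambda>w. \<phi> (X k w) * \<phi> (X n w)))
      \<le> (\<Sum>k<n. 2 * b\<^sup>2 * (1 - c) * (1 - c) ^ (n - Suc k))"
  proof (rule sum_mono)
    fix k assume "k \<in> {..<n}"
    then have "k + (n - k) = n" "n - k = Suc (n - Suc k)" by auto
    then show "expectation (\<lambda>w. \<phi> (X k w) * \<phi> (X n w)) \<le> 2 * b\<^sup>2 * (1 - c) * (1 - c) ^ (n - Suc k)"
      using centered_correlation_le[OF assms, of k "n - k"] by (simp add: mult.assoc)
  qed
  also have "\<dots> = 2 * b\<^sup>2 * (1 - c) * (\<Sum>k<n. (1 - c) ^ k)"
    by (simp add: sum.nat_diff_reindex flip: sum_distrib_left)
  also have "\<dots> \<le> 2 * b\<^sup>2 * (1 - c) * (1 / c)"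
    using c_le_1 c_pos by (intro mult_left_mono) (auto simp: sum_gp_strict divide_right_mono)
  finally show ?thesis by simp
qed

lemma centered_second_moment_le:
  assumes \<mu>: "invariant \<mu>" and [measurable]: "\<phi> \<in> borel_measurable N" and \<phi>: "\<phi> \<in> space N \<rightarrow> {-b..b}"
    and centered: "(\<integral>z. \<phi> z \<partial>\<mu>) = 0"
  shows "expectation (\<lambda>w. (\<Sum>k<n. \<phi> (X k w))\<^sup>2) \<le> 4 * b\<^sup>2 / c * n"
proof (induction n)
  case (Suc n)
  have "\<bar>\<phi> (X k w)\<bar> \<le> b" if "w \<in> space P" for k w
    using \<phi> X_in_space[OF that] by (auto simp: abs_le_iff minus_le_iff Pi_iff)
  then have integrable_product: "integrable P (\<lambda>w. \<phi> (X i w) * \<phi> (X j w))" for i j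
    by (intro integrable_const_bound[where B="b * b"] AE_I2)
      (auto simp: abs_mult intro!: mult_mono order_trans[OF abs_ge_zero])
  then have integrable_square: "integrable P (\<lambda>w. (\<Sum>k<n. \<phi> (X k w))\<^sup>2)"
    by (simp add: power2_eq_square sum_product)
  have diagonal: "expectation (\<lambda>w. (\<phi> (X n w))\<^sup>2) \<le> 2 * b\<^sup>2"
    using centered_correlation_le[OF \<mu> _ \<phi> centered, of n 0] by (simp add: power2_eq_square)
  have "(\<lambda>w. (\<Sum>k<Suc n. \<phi> (X k w))\<^sup>2)
      = (\<lambda>w. (\<Sum>k<n. \<phi> (X k w))\<^sup>2 + 2 * (\<Sum>k<n. \<phi> (X k w) * \<phi> (X n w)) + (\<phi> (X n w))\<^sup>2)"
    by (simp add: fun_eq_iff power2_sum sum_distrib_right[symmetric])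
  then have "expectation (\<lambda>w. (\<Sum>k<Suc n. \<phi> (X k w))\<^sup>2)
      = expectation (\<lambda>w. (\<Sum>k<n. \<phi> (X k w))\<^sup>2)
        + 2 * (\<Sum>k<n. expectation (\<lambda>w. \<phi> (X k w) * \<phi> (X n w))) + expectation (\<lambda>w. (\<phi> (X n w))\<^sup>2)"
    using integrable_product integrable_square integrable_product[of n n]
    by (simp add: power2_eq_square[of "\<phi> _"])
  also have "\<dots> \<le> 4 * b\<^sup>2 / c * n + 2 * (2 * b\<^sup>2 * ((1 - c) / c)) + 2 * b\<^sup>2"
    using Suc sum_centered_correlation_le[OF \<mu> _ \<phi> centered, of n] diagonal by simp
  also have "\<dots> \<le> 4 * b\<^sup>2 / c * Suc n"
    using c_pos by (simp add: field_simps)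
  finally show ?case .
qed simp

lemma mean_square_deviation_le:
  assumes \<mu>: "invariant \<mu>" and [measurable]: "\<phi> \<in> borel_measurable N" and \<phi>: "\<phi> \<in> space N \<rightarrow> {-b..b}"
    and n_pos: "0 < n"
  shows "expectation (\<lambda>w. ((\<Sum>k<n. \<phi> (X k w)) / n - (\<integral>z. \<phi> z \<partial>\<mu>))\<^sup>2) \<le> (4 * b)\<^sup>2 / (c * n)"
proof -
  have "prob_space \<mu>" and sets_\<mu>[measurable_cong]: "sets \<mu> = sets N"
    using \<mu> by (auto simp: invariant_def)
  interpret \<mu>: prob_space \<mu> by fact
  have mean: "integrable \<mu> \<phi>" "(\<integral>z. \<phi> z \<partial>\<mu>) \<in> {-b..b}"
    using \<mu>.integrable_interval_valued[of \<phi> "-b" b] \<mu>.integral_in_interval[of \<phi> "-b" b] \<phi>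
    by (simp_all add: sets_eq_imp_space_eq[OF sets_\<mu>])
  define \<psi> where "\<psi> z = \<phi> z - (\<integral>z. \<phi> z \<partial>\<mu>)" for z
  have [measurable]: "\<psi> \<in> borel_measurable N" unfolding \<psi>_def by measurable
  have centered: "(\<integral>z. \<psi> z \<partial>\<mu>) = 0" using mean by (simp add: \<psi>_def \<mu>.prob_space)
  have \<psi>_interval: "\<psi> \<in> space N \<rightarrow> {- (2 * b)..2 * b}"
    using \<phi> mean(2) by (fastforce simp: \<psi>_def Pi_iff)
  have "(\<Sum>k<n. \<phi> (X k w)) / n - (\<integral>z. \<phi> z \<partial>\<mu>) = (\<Sum>k<n. \<psi> (X k w)) / n" for w
    using n_pos by (simp add: \<psi>_def sum_subtractf field_simps)
  then have "expectation (\<lambda>w. ((\<Sum>k<n. \<phi> (X k w)) / n - (\<integral>z. \<phi> z \<partial>\<mu>))\<^sup>2)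
      = expectation (\<lambda>w. (\<Sum>k<n. \<psi> (X k w))\<^sup>2) / n\<^sup>2"
    by (simp add: power_divide)
  also have "\<dots> \<le> 4 * (2 * b)\<^sup>2 / c * n / n\<^sup>2"
    by (intro divide_right_mono centered_second_moment_le[OF \<mu> _ \<psi>_interval centered]) auto
  also have "\<dots> = (4 * b)\<^sup>2 / (c * n)"
    using n_pos by (simp add: power2_eq_square field_simps)
  finally show ?thesis .
qed

lemma bounded_mean_deviation_le:
  assumes \<mu>: "invariant \<mu>" and [measurable]: "\<phi> \<in> borel_measurable N" and \<phi>: "\<phi> \<in> space N \<rightarrow> {-b..b}"
    and n_pos: "0 < n"
  shows "expectation (\<lambda>w. \<bar>(\<Sum>k<n. \<phi> (X k w)) / n - (\<integral>z. \<phi> z \<partial>\<mu>)\<bar>) \<le> 4 * b / sqrt (c * n)"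
proof -
  let ?D = "\<lambda>w. (\<Sum>k<n. \<phi> (X k w)) / n - (\<integral>z. \<phi> z \<partial>\<mu>)"
  have \<phi>_le: "\<bar>\<phi> (X k w)\<bar> \<le> b" if "w \<in> space P" for k w
    using \<phi> X_in_space[OF that] by (auto simp: abs_le_iff minus_le_iff Pi_iff)
  have "integrable P (\<lambda>w. (?D w)\<^sup>2)"
  proof (rule integrable_const_bound[where B="(b + \<bar>\<integral>z. \<phi> z \<partial>\<mu>\<bar>)\<^sup>2"])
    have "\<bar>?D w\<bar> \<le> b + \<bar>\<integral>z. \<phi> z \<partial>\<mu>\<bar>" if "w \<in> space P" for w
    proof -
      have "\<bar>\<Sum>k<n. \<phi> (X k w)\<bar> \<le> (\<Sum>k<n. b)"
        by (rule order_trans[OF sum_abs sum_mono]) (rule \<phi>_le[OF that])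
      then have "\<bar>(\<Sum>k<n. \<phi> (X k w)) / n\<bar> \<le> b" using n_pos by (simp add: pos_divide_le_eq mult.commute)
      then show ?thesis by linarith
    qed
    then show "AE w in P. norm ((?D w)\<^sup>2) \<le> (b + \<bar>\<integral>z. \<phi> z \<partial>\<mu>\<bar>)\<^sup>2"
      unfolding norm_power by (intro AE_I2 power_mono) auto
  qed measurable
  then have "expectation (\<lambda>w. \<bar>?D w\<bar>) \<le> sqrt (expectation (\<lambda>w. (?D w)\<^sup>2))"
    by (intro expectation_abs_le_sqrt) auto
  also have "\<dots> \<le> sqrt ((4 * b)\<^sup>2 / (c * n))"
    by (intro real_sqrt_le_mono mean_square_deviation_le assms)
  also have "\<dots> = 4 * b / sqrt (c * n)"
  proof -
    obtain w where "w \<in> space P" using not_empty by blast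
    then have "0 \<le> b" using \<phi>_le[of w 0] by linarith
    then show ?thesis unfolding real_sqrt_divide by (subst real_sqrt_abs) simp
  qed
  finally show ?thesis .
qed

end

locale dominated_doeblin_kernel = doeblin_kernel N Q \<nu> c for N :: "'z measure" and Q \<nu> c +
  fixes C :: real
  assumes domination: "z \<in> space N \<Longrightarrow> Q z \<le> scale_measure (ennreal C) \<nu>"
begin

lemma emeasure_domination: "z \<in> space N \<Longrightarrow> emeasure (Q z) A \<le> ennreal C * emeasure \<nu> A"
  using le_measureD3[OF domination, of z A] by (simp add: sets_\<nu> sets_kernel)

lemma C_pos: "0 < C"
proof -
  obtain z where z_space: "z \<in> space N" using space_not_empty by blast
  show ?thesis
    using emeasure_domination[OF z_space, of "space N"]
      prob_space.emeasure_space_1[OF prob_kernel[OF z_space]]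
    by (cases "0 < C") (auto simp: space_kernel[OF z_space] ennreal_neg)
qed

lemma bind_kernel_dominated:
  assumes \<rho>: "prob_space \<rho>" "sets \<rho> = sets N"
  shows "\<rho> \<bind> Q \<le> scale_measure (ennreal C) \<nu>"
proof (rule le_measure[THEN iffD2, OF _ ballI])
  interpret \<rho>: prob_space \<rho> by fact
  note [measurable_cong] = \<rho>(2)
  have space_\<rho>: "space \<rho> = space N" by (rule sets_eq_imp_space_eq[OF \<rho>(2)])
  show sets_bind: "sets (\<rho> \<bind> Q) = sets (scale_measure (ennreal C) \<nu>)"
    using \<rho> by (subst sets_bind'[OF _ kernel]) (auto simp: space_prob_algebra sets_\<nu>)
  fix A assume "A \<in> sets (\<rho> \<bind> Q)"
  then have [measurable]: "A \<in> sets N" using sets_bind by (simp add: sets_\<nu>)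
  have "emeasure (\<rho> \<bind> Q) A = (\<integral>\<^sup>+z. emeasure (Q z) A \<partial>\<rho>)"
    using \<rho>.not_empty by (rule emeasure_bind) measurable
  also have "\<dots> \<le> (\<integral>\<^sup>+z. ennreal C * emeasure \<nu> A \<partial>\<rho>)"
    by (intro nn_integral_mono emeasure_domination) (simp add: space_\<rho>)
  finally show "emeasure (\<rho> \<bind> Q) A \<le> emeasure (scale_measure (ennreal C) \<nu>) A"
    by (simp add: \<rho>.emeasure_space_1)
qed

lemma invariant_dominated: "invariant \<mu> \<Longrightarrow> \<mu> \<le> scale_measure (ennreal C) \<nu>"
  using bind_kernel_dominated[of \<mu>] by (simp add: invariant_def)

end

definition truncate :: "real \<Rightarrow> real \<Rightarrow> real" where
  "truncate L y = max (- L) (min L y)"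

definition excess :: "real \<Rightarrow> real \<Rightarrow> real" where
  "excess L y = max 0 (\<bar>y\<bar> - L)"

lemma truncate_measurable[measurable]: "truncate L \<in> borel_measurable borel"
  and excess_measurable[measurable]: "excess L \<in> borel_measurable borel"
  unfolding truncate_def excess_def by measurable

lemma truncate_interval: "0 \<le> L \<Longrightarrow> truncate L y \<in> {-L..L}"
  by (auto simp: truncate_def)

lemma diff_truncate: "0 \<le> L \<Longrightarrow> \<bar>y - truncate L y\<bar> = excess L y"
  by (auto simp: truncate_def excess_def)

lemma excess_nonneg: "0 \<le> excess L y"
  by (simp add: excess_def)

lemma excess_le: "0 \<le> L \<Longrightarrow> excess L y \<le> \<bar>y\<bar>"
  by (simp add: excess_def)

lemma integrable_excess:
  "integrable M \<phi> \<Longrightarrow> 0 \<le> L \<Longrightarrow> integrable M (\<lambda>z. excess L (\<phi> z))"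
  by (rule Bochner_Integration.integrable_bound[of M \<phi>]) (auto simp: excess_nonneg excess_le)

lemma integrable_truncate:
  "integrable M \<phi> \<Longrightarrow> 0 \<le> L \<Longrightarrow> integrable M (\<lambda>z. truncate L (\<phi> z))"
  by (rule Bochner_Integration.integrable_bound[of M \<phi>]) (auto simp: truncate_def)

lemma integral_excess_tendsto_0:
  assumes integrable: "integrable M \<phi>"
  shows "(\<lambda>L::nat. \<integral>z. excess L (\<phi> z) \<partial>M) \<longlonglongrightarrow> 0"
proof -
  have "(\<lambda>L::nat. \<integral>z. excess L (\<phi> z) \<partial>M) \<longlonglongrightarrow> (\<integral>z. 0 \<partial>M)"
  proof (rule integral_dominated_convergence[where w="\<lambda>z. \<bar>\<phi> z\<bar>"])
    have "\<forall>\<^sub>F L::nat in sequentially. excess L y = 0" for y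
      using eventually_ge_at_top[of "nat \<lceil>\<bar>y\<bar>\<rceil>"]
      by eventually_elim (simp add: excess_def nat_ceiling_le_eq)
    then show "AE z in M. (\<lambda>L::nat. excess L (\<phi> z)) \<longlonglongrightarrow> 0"
      by (intro AE_I2 tendsto_eventually)
  qed (use integrable in \<open>auto simp: excess_nonneg excess_le\<close>)
  then show ?thesis by simp
qed

lemma (in dominated_doeblin_kernel)
  fixes \<phi> :: "'z \<Rightarrow> real"
  assumes \<mu>: "invariant \<mu>" and \<phi>: "integrable \<nu> \<phi>"
  shows integrable_invariant: "integrable \<mu> \<phi>"
    and integral_abs_invariant_le: "(\<integral>z. \<bar>\<phi> z\<bar> \<partial>\<mu>) \<le> C * (\<integral>z. \<bar>\<phi> z\<bar> \<partial>\<nu>)"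
  using integrable_le_scale_measure[OF _ invariant_dominated[OF \<mu>] \<phi>]
    integral_abs_le_scale_measure[OF _ invariant_dominated[OF \<mu>] \<phi>] \<mu> C_pos
  by (auto simp: invariant_def sets_\<nu>)

lemma (in dominated_doeblin_kernel) truncation_error_invariant:
  assumes \<mu>: "invariant \<mu>" and \<phi>: "integrable \<nu> \<phi>" and L_nonneg: "0 \<le> L"
  shows "\<bar>(\<integral>z. \<phi> z \<partial>\<mu>) - (\<integral>z. truncate L (\<phi> z) \<partial>\<mu>)\<bar> \<le> C * (\<integral>z. excess L (\<phi> z) \<partial>\<nu>)"
proof -
  have integrable: "integrable \<mu> \<phi>" by (rule integrable_invariant[OF \<mu> \<phi>])
  have "\<bar>(\<integral>z. \<phi> z \<partial>\<mu>) - (\<integral>z. truncate L (\<phi> z) \<partial>\<mu>)\<bar> = \<bar>\<integral>z. \<phi> z - truncate L (\<phi> z) \<partial>\<mu>\<bar>"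
    using integrable L_nonneg by (simp add: integrable_truncate)
  also have "\<dots> \<le> (\<integral>z. \<bar>\<phi> z - truncate L (\<phi> z)\<bar> \<partial>\<mu>)" by (rule integral_abs_bound)
  also have "\<dots> = (\<integral>z. \<bar>excess L (\<phi> z)\<bar> \<partial>\<mu>)" by (simp add: diff_truncate[OF L_nonneg] excess_nonneg)
  also have "\<dots> \<le> C * (\<integral>z. \<bar>excess L (\<phi> z)\<bar> \<partial>\<nu>)"
    by (rule integral_abs_invariant_le[OF \<mu> integrable_excess[OF \<phi> L_nonneg]])
  finally show ?thesis by (simp add: excess_nonneg)
qed

locale dominated_doeblin_chain = dominated_doeblin_kernel N Q \<nu> c C + markov_chain N Q P X
  for N :: "'z measure" and Q \<nu> c C and P :: "'w measure" and X

sublocale dominated_doeblin_chain \<subseteq> doeblin_chain ..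

context dominated_doeblin_chain begin

lemma distr_Suc_dominated: "distr P N (X (Suc n)) \<le> scale_measure (ennreal C) \<nu>"
  unfolding distr_Suc by (intro bind_kernel_dominated prob_space_distr) simp_all

lemma
  assumes \<phi>: "integrable \<nu> \<phi>"
  shows integrable_X_Suc: "integrable P (\<lambda>w. \<phi> (X (Suc n) w))"
    and expectation_abs_X_Suc_le: "expectation (\<lambda>w. \<bar>\<phi> (X (Suc n) w)\<bar>) \<le> C * (\<integral>z. \<bar>\<phi> z\<bar> \<partial>\<nu>)"
proof -
  have sets: "sets (distr P N (X (Suc n))) = sets \<nu>" by (simp add: sets_\<nu>)
  have [measurable]: "\<phi> \<in> borel_measurable N"
    using borel_measurable_integrable[OF \<phi>] by (simp add: measurable_cong_sets[OF sets_\<nu> refl])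
  show "integrable P (\<lambda>w. \<phi> (X (Suc n) w))"
    using integrable_le_scale_measure[OF sets distr_Suc_dominated \<phi>] C_pos
    by (simp add: integrable_distr_eq)
  show "expectation (\<lambda>w. \<bar>\<phi> (X (Suc n) w)\<bar>) \<le> C * (\<integral>z. \<bar>\<phi> z\<bar> \<partial>\<nu>)"
    using integral_abs_le_scale_measure[OF sets distr_Suc_dominated \<phi>] C_pos
    by (simp add: integral_distr)
qed

lemma integrable_X:
  fixes \<phi> :: "'z \<Rightarrow> real"
  assumes "integrable \<nu> \<phi>" "integrable P (\<lambda>w. \<phi> (X 0 w))"
  shows "integrable P (\<lambda>w. \<phi> (X n w))"
  using assms integrable_X_Suc by (cases n) auto

lemma sum_expectation_excess_le:
  assumes \<phi>: "integrable \<nu> \<phi>" and \<phi>0: "integrable P (\<lambda>w. \<phi> (X 0 w))" and L_nonneg: "0 \<le> L"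
  shows "(\<Sum>k<n. expectation (\<lambda>w. excess L (\<phi> (X k w))))
    \<le> expectation (\<lambda>w. \<bar>\<phi> (X 0 w)\<bar>) + n * (C * (\<integral>z. excess L (\<phi> z) \<partial>\<nu>))"
proof (cases n)
  case (Suc m)
  have "expectation (\<lambda>w. excess L (\<phi> (X 0 w))) \<le> expectation (\<lambda>w. \<bar>\<phi> (X 0 w)\<bar>)"
    using \<phi>0 integrable_excess[OF \<phi>0 L_nonneg] excess_le[OF L_nonneg] by (intro integral_mono) auto
  moreover have "(\<Sum>k<m. expectation (\<lambda>w. excess L (\<phi> (X (Suc k) w))))
      \<le> m * (C * (\<integral>z. excess L (\<phi> z) \<partial>\<nu>))"
    using sum_mono[of "{..<m}", OF expectation_abs_X_Suc_le[OF integrable_excess[OF \<phi> L_nonneg]]]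
    by (simp add: excess_nonneg)
  moreover have "0 \<le> C * (\<integral>z. excess L (\<phi> z) \<partial>\<nu>)" using C_pos by (simp add: excess_nonneg)
  ultimately show ?thesis by (simp add: Suc sum.lessThan_Suc_shift distrib_right del: sum.lessThan_Suc)
qed simp

lemma mean_deviation_le:
  assumes \<mu>: "invariant \<mu>" and \<phi>: "integrable \<nu> \<phi>" and \<phi>0: "integrable P (\<lambda>w. \<phi> (X 0 w))"
    and L_nonneg: "0 \<le> L" and n_pos: "0 < n"
  shows "expectation (\<lambda>w. \<bar>(\<Sum>k<n. \<phi> (X k w)) / n - (\<integral>z. \<phi> z \<partial>\<mu>)\<bar>)
    \<le> 4 * L / sqrt (c * n) + expectation (\<lambda>w. \<bar>\<phi> (X 0 w)\<bar>) / n + 2 * C * (\<integral>z. excess L (\<phi> z) \<partial>\<nu>)"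
proof -
  let ?\<tau> = "\<integral>z. excess L (\<phi> z) \<partial>\<nu>" and ?t = "\<lambda>z. truncate L (\<phi> z)" and ?e = "\<lambda>z. excess L (\<phi> z)"
  have [measurable]: "\<phi> \<in> borel_measurable N"
    using borel_measurable_integrable[OF \<phi>] by (simp add: measurable_cong_sets[OF sets_\<nu> refl])
  have integrable: "integrable P (\<lambda>w. \<phi> (X k w))" "integrable P (\<lambda>w. ?t (X k w))"
    "integrable P (\<lambda>w. ?e (X k w))" for k
    using integrable_X[OF \<phi> \<phi>0, of k] L_nonneg by (auto intro: integrable_truncate integrable_excess)
  have deviation_le: "\<bar>(\<Sum>k<n. \<phi> (X k w)) / n - (\<integral>z. \<phi> z \<partial>\<mu>)\<bar>
      \<le> \<bar>(\<Sum>k<n. ?t (X k w)) / n - (\<integral>z. ?t z \<partial>\<mu>)\<bar> + (\<Sum>k<n. ?e (X k w)) / n + C * ?\<tau>" for w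
  proof -
    have "\<bar>(\<Sum>k<n. \<phi> (X k w)) - (\<Sum>k<n. ?t (X k w))\<bar> \<le> (\<Sum>k<n. \<bar>\<phi> (X k w) - ?t (X k w)\<bar>)"
      unfolding sum_subtractf[symmetric] by (rule sum_abs)
    then have "\<bar>(\<Sum>k<n. \<phi> (X k w)) / n - (\<Sum>k<n. ?t (X k w)) / n\<bar> \<le> (\<Sum>k<n. ?e (X k w)) / n"
      by (simp add: diff_truncate[OF L_nonneg] divide_right_mono flip: diff_divide_distrib)
    then show ?thesis using truncation_error_invariant[OF \<mu> \<phi> L_nonneg] by linarith
  qed
  have "expectation (\<lambda>w. \<bar>(\<Sum>k<n. \<phi> (X k w)) / n - (\<integral>z. \<phi> z \<partial>\<mu>)\<bar>)
      \<le> expectation (\<lambda>w. \<bar>(\<Sum>k<n. ?t (X k w)) / n - (\<integral>z. ?t z \<partial>\<mu>)\<bar> + (\<Sum>k<n. ?e (X k w)) / n + C * ?\<tau>)"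
    using deviation_le integrable by (intro integral_mono) auto
  also have "\<dots> = expectation (\<lambda>w. \<bar>(\<Sum>k<n. ?t (X k w)) / n - (\<integral>z. ?t z \<partial>\<mu>)\<bar>)
      + (\<Sum>k<n. expectation (\<lambda>w. ?e (X k w))) / n + C * ?\<tau>"
    using integrable by (simp add: prob_space)
  also have "\<dots> \<le> 4 * L / sqrt (c * n) + (expectation (\<lambda>w. \<bar>\<phi> (X 0 w)\<bar>) + n * (C * ?\<tau>)) / n + C * ?\<tau>"
    using truncate_interval[OF L_nonneg]
    by (intro add_mono divide_right_mono sum_expectation_excess_le[OF \<phi> \<phi>0 L_nonneg]
        bounded_mean_deviation_le[OF \<mu> _ _ n_pos]) auto
  finally show ?thesis using n_pos by (simp add: add_divide_distrib)
qed

end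

context dominated_doeblin_kernel begin

theorem uniform_mean_ergodic_theorem:
  assumes chain: "\<And>x. x \<in> S \<Longrightarrow> markov_chain N Q (P x) X"
    and \<mu>: "invariant \<mu>" and \<phi>: "integrable \<nu> \<phi>"
    and initial: "\<And>x. x \<in> S \<Longrightarrow> integrable (P x) (\<lambda>w. \<phi> (X 0 w))"
      "\<And>x. x \<in> S \<Longrightarrow> (\<integral>w. \<bar>\<phi> (X 0 w)\<bar> \<partial>P x) \<le> B"
  shows "uniform_limit S
    (\<lambda>n x. \<integral>w. \<bar>(\<Sum>k<n. \<phi> (X k w)) / real n - (\<integral>z. \<phi> z \<partial>\<mu>)\<bar> \<partial>P x) (\<lambda>_. 0) sequentially"
proof (rule uniform_limitI)
  fix \<epsilon> :: real assume \<epsilon>_pos: "0 < \<epsilon>"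
  have "(\<lambda>L::nat. 2 * C * (\<integral>z. excess L (\<phi> z) \<partial>\<nu>)) \<longlonglongrightarrow> 2 * C * 0"
    by (intro tendsto_mult_left integral_excess_tendsto_0 \<phi>)
  then obtain L :: nat where tail_small: "2 * C * (\<integral>z. excess L (\<phi> z) \<partial>\<nu>) < \<epsilon> / 2"
    using order_tendstoD(2)[of _ 0 sequentially "\<epsilon> / 2"] \<epsilon>_pos eventually_happens'[OF sequentially_bot]
    by fastforce
  have "(\<lambda>n. 4 * real L / sqrt (c * real n) + B / real n) \<longlonglongrightarrow> 0"
    using c_pos by real_asymp
  then have "\<forall>\<^sub>F n in sequentially. 4 * real L / sqrt (c * real n) + B / real n < \<epsilon> / 2"
    using \<epsilon>_pos by (intro order_tendstoD(2)) auto
  then show "\<forall>\<^sub>F n in sequentially. \<forall>x\<in>S.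
      dist (\<integral>w. \<bar>(\<Sum>k<n. \<phi> (X k w)) / real n - (\<integral>z. \<phi> z \<partial>\<mu>)\<bar> \<partial>P x) 0 < \<epsilon>"
    using eventually_gt_at_top[of 0]
  proof eventually_elim
    case (elim n)
    show ?case
    proof
      fix x assume x_in_S: "x \<in> S"
      interpret dominated_doeblin_chain N Q \<nu> c C "P x" X
        using dominated_doeblin_kernel_axioms chain[OF x_in_S] by (rule dominated_doeblin_chain.intro)
      have "(\<integral>w. \<bar>\<phi> (X 0 w)\<bar> \<partial>P x) / n \<le> B / n" by (intro divide_right_mono initial x_in_S) simp
      then have "(\<integral>w. \<bar>(\<Sum>k<n. \<phi> (X k w)) / real n - (\<integral>z. \<phi> z \<partial>\<mu>)\<bar> \<partial>P x) < \<epsilon>"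
        using mean_deviation_le[OF \<mu> \<phi> initial(1)[OF x_in_S], of "real L" n] tail_small elim by linarith
      then show "dist (\<integral>w. \<bar>(\<Sum>k<n. \<phi> (X k w)) / real n - (\<integral>z. \<phi> z \<partial>\<mu>)\<bar> \<partial>P x) 0 < \<epsilon>"
        by simp
    qed
  qed
qed

end

section \<open>The chain of states and holding times\<close>

lemma nn_integral_holding_law:
  assumes "0 \<le> c" shows "(\<integral>\<^sup>+s. s \<partial>holding_law c) = 1 / ennreal c"
proof (cases "c = 0")
  case True
  then show ?thesis by (simp add: holding_law_def nn_integral_return)
next
  case False
  then have c_pos: "0 < c" using assms by simp
  have "(\<integral>\<^sup>+s. s \<partial>holding_law c) = (\<integral>\<^sup>+s. ennreal (exponential_density c s) * ennreal s \<partial>lborel)"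
    using False by (simp add: holding_law_def nn_integral_distr nn_integral_density)
  also have "\<dots> = (\<integral>\<^sup>+s. ennreal (exponential_density c s * s ^ 1) \<partial>lborel)"
    using c_pos by (intro nn_integral_cong)
      (auto simp: exponential_density_def ennreal_mult' simp flip: ennreal_mult)
  also have "\<dots> = ennreal (fact (0 + 1) / (fact 0 * c ^ 1))"
    by (rule nn_integral_erlang_ith_moment[OF c_pos])
  finally show ?thesis using c_pos divide_ennreal[of 1 c] by simp
qed

lemma sets_holding_law[measurable_cong, simp]: "sets (holding_law c) = sets borel"
  by (simp add: holding_law_def)

context jump_kernel begin

sublocale base: markov_kernel borel K
  by (rule markov_kernel.intro) (rule K)

lemma measurable_holding[measurable]: "(\<lambda>y. holding_law (r y)) \<in> borel \<rightarrow>\<^sub>M prob_algebra borel"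
  by (rule holding_law_measurable[OF r nn])

lemma measurable_holding_pair[measurable]:
  "(\<lambda>y. distr (holding_law (r y)) (borel \<Otimes>\<^sub>M borel) (Pair y)) \<in> borel \<rightarrow>\<^sub>M prob_algebra (borel \<Otimes>\<^sub>M borel)"
  by measurable

lemma measurable_holding_pair_subprob:
  assumes "sets \<mu> = sets borel"
  shows "(\<lambda>y. distr (holding_law (r y)) (borel \<Otimes>\<^sub>M borel) (Pair y))
    \<in> \<mu> \<rightarrow>\<^sub>M subprob_algebra (borel \<Otimes>\<^sub>M borel)"
  using measurable_prob_algebraD[OF measurable_holding_pair]
  by (simp add: measurable_cong_sets[OF assms refl])

lemma nn_integral_with_holding:
  assumes sets_\<mu>: "sets \<mu> = sets borel"
    and measurable[measurable]: "g \<in> borel_measurable (borel \<Otimes>\<^sub>M borel)"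
  shows "(\<integral>\<^sup>+z. g z \<partial>with_holding r \<mu>) = (\<integral>\<^sup>+y. \<integral>\<^sup>+s. g (y, s) \<partial>holding_law (r y) \<partial>\<mu>)"
proof -
  have "(\<integral>\<^sup>+z. g z \<partial>with_holding r \<mu>)
      = (\<integral>\<^sup>+y. \<integral>\<^sup>+z. g z \<partial>distr (holding_law (r y)) (borel \<Otimes>\<^sub>M borel) (Pair y) \<partial>\<mu>)"
    unfolding with_holding_def
    by (rule nn_integral_bind[OF measurable measurable_holding_pair_subprob[OF sets_\<mu>]])
  also have "\<dots> = (\<integral>\<^sup>+y. \<integral>\<^sup>+s. g (y, s) \<partial>holding_law (r y) \<partial>\<mu>)"
    by (intro nn_integral_cong nn_integral_distr) measurable
  finally show ?thesis .
qed

lemma measurable_nn_integral_holding: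
  assumes [measurable]: "g \<in> borel_measurable (borel \<Otimes>\<^sub>M borel)"
  shows "(\<lambda>y. \<integral>\<^sup>+s. g (y, s) \<partial>holding_law (r y)) \<in> borel_measurable borel"
  by (rule nn_integral_measurable_subprob_algebra2[OF _ measurable_prob_algebraD[OF measurable_holding]])
    (simp add: case_prod_eta)

lemma
  assumes "prob_space \<mu>" "sets \<mu> = sets borel"
  shows prob_space_with_holding: "prob_space (with_holding r \<mu>)"
    and sets_with_holding: "sets (with_holding r \<mu>) = sets (borel \<Otimes>\<^sub>M borel)"
proof -
  have "(\<lambda>_. \<mu>) \<in> count_space UNIV \<rightarrow>\<^sub>M prob_algebra borel"
    using assms by (auto simp: space_prob_algebra)
  from measurable_space[OF with_holding_measurable[OF r nn this]]
  show "prob_space (with_holding r \<mu>)" "sets (with_holding r \<mu>) = sets (borel \<Otimes>\<^sub>M borel)"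
    by (simp_all add: space_prob_algebra)
qed

lemma
  assumes \<mu>: "prob_space \<mu>" "sets \<mu> = sets borel" and \<nu>: "prob_space \<nu>" "sets \<nu> = sets borel"
  shows scale_with_holding_le:
      "scale_measure a \<nu> \<le> \<mu> \<Longrightarrow> scale_measure a (with_holding r \<nu>) \<le> with_holding r \<mu>"
    and with_holding_le_scale:
      "\<mu> \<le> scale_measure a \<nu> \<Longrightarrow> with_holding r \<mu> \<le> scale_measure a (with_holding r \<nu>)"
proof -
  note sets_eq = sets_with_holding[OF \<mu>] sets_with_holding[OF \<nu>]
  have emeasure_eq: "emeasure (with_holding r \<rho>) A
      = (\<integral>\<^sup>+y. \<integral>\<^sup>+s. indicator A (y, s) \<partial>holding_law (r y) \<partial>\<rho>)"
    and section_measurable: "(\<lambda>y. \<integral>\<^sup>+s. indicator A (y, s) \<partial>holding_law (r y)) \<in> borel_measurable \<rho>"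
    if A_sets[measurable]: "A \<in> sets (borel \<Otimes>\<^sub>M borel)"
      and \<rho>: "prob_space \<rho>" "sets \<rho> = sets borel" for \<rho> A
    using nn_integral_with_holding[OF \<rho>(2), of "indicator A"]
      measurable_nn_integral_holding[of "indicator A"] A_sets
    by (simp_all add: sets_with_holding[OF \<rho>] measurable_cong_sets[OF \<rho>(2) refl])
  show "scale_measure a (with_holding r \<nu>) \<le> with_holding r \<mu>" if "scale_measure a \<nu> \<le> \<mu>"
    by (rule le_measure[THEN iffD2, OF _ ballI])
      (use that \<mu> \<nu> in \<open>auto simp: sets_eq emeasure_eq
        intro!: scale_measure_le_nn_integral section_measurable\<close>)
  show "with_holding r \<mu> \<le> scale_measure a (with_holding r \<nu>)" if "\<mu> \<le> scale_measure a \<nu>"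
    by (rule le_measure[THEN iffD2, OF _ ballI])
      (use that \<mu> \<nu> in \<open>auto simp: sets_eq emeasure_eq
        intro!: nn_integral_le_scale_measure section_measurable\<close>)
qed

definition pair_kernel :: "'a \<times> ennreal \<Rightarrow> ('a \<times> ennreal) measure" where
  "pair_kernel z = with_holding r (K (fst z))"

lemma prob_K: "prob_space (K x)" and sets_K: "sets (K x) = sets borel"
  using base.prob_kernel base.sets_kernel by auto

sublocale pair: markov_kernel "borel \<Otimes>\<^sub>M borel" pair_kernel
  by (rule markov_kernel.intro, unfold pair_kernel_def[abs_def])
    (rule with_holding_measurable[OF r nn], measurable)

lemma with_holding_bind_pair_kernel:
  assumes \<mu>: "prob_space \<mu>" "sets \<mu> = sets borel"
  shows "with_holding r \<mu> \<bind> pair_kernel = with_holding r (\<mu> \<bind> K)"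
proof -
  have holding_bind: "distr (holding_law (r y)) (borel \<Otimes>\<^sub>M borel) (Pair y) \<bind> pair_kernel
      = with_holding r (K y)" for y
  proof -
    have prob: "prob_space (holding_law (r y))"
      using measurable_space[OF measurable_holding, of y] by (simp add: space_prob_algebra)
    have "distr (holding_law (r y)) (borel \<Otimes>\<^sub>M borel) (Pair y) \<bind> pair_kernel
        = holding_law (r y) \<bind> (\<lambda>s. pair_kernel (y, s))"
      using prob_space.not_empty[OF prob] by (intro bind_distr[where K="borel \<Otimes>\<^sub>M borel"]) auto
    also have "\<dots> = with_holding r (K y)"
      by (simp add: pair_kernel_def bind_const' prob prob_space_imp_subprob_space
          prob_space_with_holding prob_K sets_K)
    finally show ?thesis .
  qed
  have "with_holding r \<mu> \<bind> pair_kernel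
      = \<mu> \<bind> (\<lambda>y. distr (holding_law (r y)) (borel \<Otimes>\<^sub>M borel) (Pair y) \<bind> pair_kernel)"
    unfolding with_holding_def
    by (rule bind_assoc[OF measurable_holding_pair_subprob[OF \<mu>(2)] pair.subprob_kernel])
  also have "\<dots> = \<mu> \<bind> (\<lambda>y. with_holding r (K y))" by (simp add: holding_bind)
  also have "\<dots> = with_holding r (\<mu> \<bind> K)"
    unfolding with_holding_def
    by (rule bind_assoc[symmetric, OF _ measurable_holding_pair_subprob[OF refl]])
      (simp add: measurable_cong_sets[OF \<mu>(2) refl])
  finally show ?thesis .
qed

lemma invariant_with_holding: "base.invariant \<mu> \<Longrightarrow> pair.invariant (with_holding r \<mu>)"
  by (auto simp: base.invariant_def pair.invariant_def with_holding_bind_pair_kernel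
      intro!: prob_space_with_holding sets_with_holding)

lemma space_skeleton_law: "space (skeleton_law r K x) = UNIV"
  using sets_eq_imp_space_eq[OF sets_skeleton_law[of x]] by (simp add: space_PiM space_pair_measure)

declare sets_skeleton_law[measurable_cong]

abbreviation "initial_law x n \<equiv> IT.C x 0 n (\<lambda>_. undefined)"

lemma sets_initial_law: "sets (initial_law x n) = sets (PiM {0..<n} M)"
  by (subst IT.sets_C) (auto simp: space_PiM)

lemma initial_law_not_empty: "space (initial_law x n) \<noteq> {}"
  using prob_space.not_empty[OF IT.prob_space_C] by (simp add: space_PiM)

lemma distr_skeleton_restrict:
  "distr (skeleton_law r K x) (PiM {0..<n} M) (\<lambda>w. restrict w {0..<n}) = initial_law x n"
proof -
  have "IT.up_to {0..<n} = n"
    using IT.up_to_iff_Ico[of "{0..<n}" n] IT.up_to[of "{0..<n}"] by (intro antisym) auto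
  then show ?thesis
    using IT.distr_C[of n n "\<lambda>_. undefined" 0 x]
    by (simp add: skeleton_law_eq IT.distr_lim IT.CI_def space_PiM)
qed

lemma distr_skeleton_law:
  assumes "g \<in> PiM {0..<n} M \<rightarrow>\<^sub>M L"
  shows "distr (skeleton_law r K x) L (\<lambda>w. g (restrict w {0..<n})) = distr (initial_law x n) L g"
  using assms by (simp add: distr_distr comp_def flip: distr_skeleton_restrict)

lemma distr_skeleton_law_Suc:
  assumes measurable: "g \<in> PiM {0..<Suc n} M \<rightarrow>\<^sub>M L"
  shows "distr (skeleton_law r K x) L (\<lambda>w. g (restrict w {0..<Suc n}))
    = initial_law x n \<bind> (\<lambda>w. distr (step x n w) L (\<lambda>z. g (w(n := z))))"
proof -
  have eP_measurable: "IT.eP x n \<in> initial_law x n \<rightarrow>\<^sub>M subprob_algebra (PiM {0..<Suc n} M)"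
    using IT.measurable_eP by (simp add: measurable_cong_sets[OF sets_initial_law refl])
  have "distr (initial_law x (Suc n)) L g = initial_law x n \<bind> (\<lambda>w. distr (IT.eP x n w) L g)"
    using distr_bind[OF eP_measurable initial_law_not_empty measurable] by simp
  also have "\<dots> = initial_law x n \<bind> (\<lambda>w. distr (step x n w) L (\<lambda>z. g (w(n := z))))"
  proof (rule bind_cong[OF refl])
    fix w assume "w \<in> space (initial_law x n)"
    then have w_space: "w \<in> space (PiM {0..<n} M)"
      using sets_eq_imp_space_eq[OF sets_initial_law] by blast
    have "(\<lambda>z. w(n := z)) \<in> step x n w \<rightarrow>\<^sub>M PiM {0..<Suc n} M"
      using w_space by (intro measurable_fun_upd[where J="{0..<n}"])
        (auto simp: measurable_cong_sets[OF IT.sets_P refl])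
    then show "distr (IT.eP x n w) L g = distr (step x n w) L (\<lambda>z. g (w(n := z)))"
      unfolding IT.eP_def by (subst distr_distr[OF measurable]) (auto simp: comp_def)
  qed
  finally show ?thesis by (simp only: distr_skeleton_law[OF measurable])
qed

lemma with_holding_return_in_prob_algebra: "with_holding r (return borel x) \<in> space (prob_algebra (borel \<Otimes>\<^sub>M borel))"
  by (simp add: space_prob_algebra prob_space_return prob_space_with_holding sets_with_holding)

lemma distr_skeleton_initial:
  "distr (skeleton_law r K x) (borel \<Otimes>\<^sub>M borel) (\<lambda>w. w 0) = with_holding r (return borel x)"
proof -
  have "distr (skeleton_law r K x) (borel \<Otimes>\<^sub>M borel) (\<lambda>w. restrict w {0..<Suc 0} 0)
      = return (PiM {0..<0} M) (\<lambda>_. undefined)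
        \<bind> (\<lambda>w. distr (step x 0 w) (borel \<Otimes>\<^sub>M borel) (\<lambda>z. (w(0 := z)) 0))"
    by (subst distr_skeleton_law_Suc) auto
  also have "\<dots> = with_holding r (return borel x)"
    using with_holding_return_in_prob_algebra[of x]
    by (subst bind_return[where N="borel \<Otimes>\<^sub>M borel"])
      (auto simp: space_PiM distr_id2 space_prob_algebra space_subprob_algebra
        prob_space_imp_subprob_space)
  finally show ?thesis by simp
qed

lemma markov_chain_skeleton:
  "markov_chain (borel \<Otimes>\<^sub>M borel) pair_kernel (skeleton_law r K x) (\<lambda>n w. w n)"
proof -
  interpret prob_space "skeleton_law r K x" by (rule prob_space_skeleton_law)
  show ?thesis
  proof
    fix i n :: nat assume "i \<le> n"
    let ?L = "(borel \<Otimes>\<^sub>M borel) \<Otimes>\<^sub>M (borel \<Otimes>\<^sub>M borel) :: (('a \<times> ennreal) \<times> ('a \<times> ennreal)) measure"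
    have component: "(\<lambda>w. (w i, w m)) \<in> PiM {0..<k} M \<rightarrow>\<^sub>M ?L" if "m < k" "i < k" for m k
      using that by (intro measurable_Pair measurable_component_singleton[of _ "{0..<k}" M]) auto
    have "distr (skeleton_law r K x) ?L (\<lambda>w. (w i, w (Suc n)))
        = initial_law x (Suc n) \<bind> (\<lambda>w. distr (pair_kernel (w n)) ?L (Pair (w i)))"
      using distr_skeleton_law_Suc[OF component[of "Suc n" "Suc (Suc n)"], of x] \<open>i \<le> n\<close>
      by (simp add: pair_kernel_def del: IT.C.simps)
    also have "\<dots> = distr (initial_law x (Suc n)) ?L (\<lambda>w. (w i, w n))
        \<bind> (\<lambda>(y, z). distr (pair_kernel z) ?L (Pair y))"
      using \<open>i \<le> n\<close> component[of n "Suc n"] initial_law_not_empty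
      by (subst bind_distr[OF _ pair.joint_kernel_measurable])
        (simp_all add: measurable_cong_sets[OF sets_initial_law refl] del: IT.C.simps)
    also have "distr (initial_law x (Suc n)) ?L (\<lambda>w. (w i, w n))
        = distr (skeleton_law r K x) ?L (\<lambda>w. (w i, w n))"
      using distr_skeleton_law[OF component[of n "Suc n"], of x] \<open>i \<le> n\<close> by simp
    finally show "distr (skeleton_law r K x) ?L (\<lambda>w. (w i, w (Suc n)))
        = distr (skeleton_law r K x) ?L (\<lambda>w. (w i, w n))
          \<bind> (\<lambda>(y, z). distr (pair_kernel z) ?L (Pair y))" .
  qed measurable
qed

end

definition sojourn_reward :: "('a \<Rightarrow> real) \<Rightarrow> 'a \<times> ennreal \<Rightarrow> real" where
  "sojourn_reward g z = g (fst z) * enn2real (snd z)"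

definition reward :: "('a \<Rightarrow> real) \<Rightarrow> nat \<Rightarrow> (nat \<Rightarrow> 'a \<times> ennreal) \<Rightarrow> real" where
  "reward g n w = (\<Sum>k<n. sojourn_reward g (w k))"

lemma sojourn_reward_measurable[measurable]:
  assumes [measurable]: "g \<in> borel_measurable borel"
  shows "sojourn_reward g \<in> borel_measurable (borel \<Otimes>\<^sub>M borel)"
  unfolding sojourn_reward_def[abs_def] by measurable

lemma ennreal_abs_sojourn_reward_le:
  assumes "\<And>y. \<bar>g y\<bar> \<le> G"
  shows "ennreal \<bar>sojourn_reward g z\<bar> \<le> ennreal G * snd z"
proof -
  have "ennreal \<bar>sojourn_reward g z\<bar> = ennreal \<bar>g (fst z)\<bar> * ennreal (enn2real (snd z))"
    by (simp add: sojourn_reward_def abs_mult ennreal_mult)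
  also have "\<dots> \<le> ennreal G * snd z"
    using assms by (intro mult_mono ennreal_leI) (auto simp: ennreal_enn2real_if)
  finally show ?thesis .
qed

context jump_kernel begin

lemma nn_integral_holding_time:
  assumes "sets \<mu> = sets borel"
  shows "(\<integral>\<^sup>+z. snd z \<partial>with_holding r \<mu>) = (\<integral>\<^sup>+y. 1 / ennreal (r y) \<partial>\<mu>)"
  by (simp add: nn_integral_with_holding assms nn_integral_holding_law nn)

lemma
  assumes \<mu>: "prob_space \<mu>" "sets \<mu> = sets borel"
    and mean: "(\<integral>\<^sup>+y. 1 / ennreal (r y) \<partial>\<mu>) = ennreal b" "0 \<le> b"
    and [measurable]: "g \<in> borel_measurable borel" and g_bounded: "\<And>y. \<bar>g y\<bar> \<le> G"
  shows integrable_sojourn_reward: "integrable (with_holding r \<mu>) (sojourn_reward g)"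
    and integral_abs_sojourn_reward_le: "(\<integral>z. \<bar>sojourn_reward g z\<bar> \<partial>with_holding r \<mu>) \<le> G * b"
proof -
  note [measurable_cong] = sets_with_holding[OF \<mu>]
  have G_nonneg: "0 \<le> G" using g_bounded order_trans[OF abs_ge_zero] by blast
  have "(\<integral>\<^sup>+z. ennreal \<bar>sojourn_reward g z\<bar> \<partial>with_holding r \<mu>)
      \<le> (\<integral>\<^sup>+z. ennreal G * snd z \<partial>with_holding r \<mu>)"
    by (intro nn_integral_mono ennreal_abs_sojourn_reward_le g_bounded)
  also have "\<dots> = ennreal (G * b)"
    using G_nonneg mean by (simp add: nn_integral_cmult nn_integral_holding_time[OF \<mu>(2)] ennreal_mult)
  finally have nn_bound: "(\<integral>\<^sup>+z. ennreal \<bar>sojourn_reward g z\<bar> \<partial>with_holding r \<mu>) \<le> ennreal (G * b)" .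
  then show integrable: "integrable (with_holding r \<mu>) (sojourn_reward g)"
    by (intro integrableI_bounded) (auto simp: le_less_trans)
  show "(\<integral>z. \<bar>sojourn_reward g z\<bar> \<partial>with_holding r \<mu>) \<le> G * b"
    using nn_bound G_nonneg mean(2) nn_integral_eq_integral[OF integrable_abs[OF integrable]] by simp
qed

lemma nn_integral_inverse_rate_return:
  "0 < r x \<Longrightarrow> (\<integral>\<^sup>+y. 1 / ennreal (r y) \<partial>return borel x) = ennreal (1 / r x)"
  using divide_ennreal[of 1 "r x"] by (simp add: nn_integral_return)

lemma
  assumes g: "g \<in> borel_measurable borel" "\<And>y. \<bar>g y\<bar> \<le> G" and rate_pos: "0 < r x"
  shows integrable_initial_reward: "integrable (skeleton_law r K x) (\<lambda>w. sojourn_reward g (w 0))"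
    and integral_abs_initial_reward_le:
      "(\<integral>w. \<bar>sojourn_reward g (w 0)\<bar> \<partial>skeleton_law r K x) \<le> G * (1 / r x)"
proof -
  note [measurable] = g(1)
  have "prob_space (return borel x)" "sets (return borel x) = sets borel"
    by (simp_all add: prob_space_return)
  note rewards = integrable_sojourn_reward[OF this nn_integral_inverse_rate_return[OF rate_pos] _ g]
    integral_abs_sojourn_reward_le[OF this nn_integral_inverse_rate_return[OF rate_pos] _ g]
  have coordinate: "(\<lambda>w. w 0) \<in> skeleton_law r K x \<rightarrow>\<^sub>M borel \<Otimes>\<^sub>M borel" by measurable
  show "integrable (skeleton_law r K x) (\<lambda>w. sojourn_reward g (w 0))"
    using rewards(1) rate_pos integrable_distr[OF coordinate, of "sojourn_reward g"]
    by (simp add: distr_skeleton_initial)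
  show "(\<integral>w. \<bar>sojourn_reward g (w 0)\<bar> \<partial>skeleton_law r K x) \<le> G * (1 / r x)"
    using rewards(2) rate_pos integral_distr[OF coordinate, of "\<lambda>z. \<bar>sojourn_reward g z\<bar>"]
    by (simp add: distr_skeleton_initial)
qed

end

locale ergodic_jump_kernel = jump_kernel r K + base: dominated_doeblin_kernel borel K lam c C
  for r :: "'a::polish_space \<Rightarrow> real" and K lam c C +
  assumes inv_r: "(\<integral>\<^sup>+x. 1 / ennreal (r x) \<partial>lam) < \<infinity>"
begin

abbreviation "\<pi>\<^sub>0 \<equiv> skeleton_invariant K"
abbreviation "\<pi> \<equiv> ctmc_invariant r K"
abbreviation "\<Lambda> \<equiv> with_holding r lam"
abbreviation "\<Theta> \<equiv> with_holding r \<pi>\<^sub>0"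

lemmas prob_\<Lambda> = prob_space_with_holding[OF base.prob_\<nu> base.sets_\<nu>]
lemmas sets_\<Lambda>[measurable_cong] = sets_with_holding[OF base.prob_\<nu> base.sets_\<nu>]

sublocale pair: dominated_doeblin_kernel "borel \<Otimes>\<^sub>M borel" pair_kernel \<Lambda> c C
proof (intro dominated_doeblin_kernel.intro doeblin_kernel.intro doeblin_kernel_axioms.intro
    dominated_doeblin_kernel_axioms.intro)
  show "scale_measure (ennreal c) \<Lambda> \<le> pair_kernel z" "pair_kernel z \<le> scale_measure (ennreal C) \<Lambda>" for z
    unfolding pair_kernel_def
    using base.minorization base.domination
    by (auto intro!: scale_with_holding_le with_holding_le_scale base.prob_\<nu> base.sets_\<nu> prob_K sets_K)
qed (rule pair.markov_kernel_axioms prob_\<Lambda> sets_\<Lambda> base.c_pos)+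

lemma invariant_\<pi>\<^sub>0: "base.invariant \<pi>\<^sub>0"
proof -
  have "base.invariant = invariant_prob K"
    by (simp add: fun_eq_iff base.invariant_def invariant_prob_def)
  then show ?thesis
    unfolding skeleton_invariant_def using theI'[OF base.ex1_invariant] by simp
qed

lemma prob_\<pi>\<^sub>0: "prob_space \<pi>\<^sub>0" and sets_\<pi>\<^sub>0: "sets \<pi>\<^sub>0 = sets borel"
  using invariant_\<pi>\<^sub>0 by (auto simp: base.invariant_def)

lemmas sets_\<Theta>[measurable_cong] = sets_with_holding[OF prob_\<pi>\<^sub>0 sets_\<pi>\<^sub>0]

definition mean_holding :: real where
  "mean_holding = enn2real (\<integral>\<^sup>+y. 1 / ennreal (r y) \<partial>\<pi>\<^sub>0)"

lemma ennreal_mean_holding: "ennreal mean_holding = (\<integral>\<^sup>+y. 1 / ennreal (r y) \<partial>\<pi>\<^sub>0)"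
proof -
  have "(\<integral>\<^sup>+y. 1 / ennreal (r y) \<partial>\<pi>\<^sub>0) \<le> ennreal C * (\<integral>\<^sup>+y. 1 / ennreal (r y) \<partial>lam)"
    by (rule nn_integral_le_scale_measure[OF _ _ base.invariant_dominated[OF invariant_\<pi>\<^sub>0]])
      (simp_all add: sets_\<pi>\<^sub>0 base.sets_\<nu>)
  also have "\<dots> < top" using inv_r by (simp add: ennreal_mult_less_top)
  finally show ?thesis by (simp add: mean_holding_def)
qed

lemma mean_holding_pos: "0 < mean_holding"
proof (rule ccontr)
  assume "\<not> 0 < mean_holding"
  then have "(\<integral>\<^sup>+y. 1 / ennreal (r y) \<partial>\<pi>\<^sub>0) = 0"
    by (simp add: ennreal_neg flip: ennreal_mean_holding)
  moreover have "(\<lambda>y. 1 / ennreal (r y)) \<in> borel_measurable \<pi>\<^sub>0"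
    by (simp add: measurable_cong_sets[OF sets_\<pi>\<^sub>0 refl])
  ultimately have "AE y in \<pi>\<^sub>0. 1 / ennreal (r y) = 0"
    by (simp add: nn_integral_0_iff_AE)
  then have "AE y in \<pi>\<^sub>0. False"
    by (simp add: divide_ennreal_def ennreal_inverse_eq_0_iff)
  then show False using prob_space.AE_False[OF prob_\<pi>\<^sub>0] by simp
qed

lemma sets_\<pi>: "sets \<pi> = sets borel"
  by (simp add: ctmc_invariant_def Let_def sets_\<pi>\<^sub>0)

lemma nn_integral_\<pi>:
  assumes [measurable]: "g \<in> borel_measurable borel"
  shows "(\<integral>\<^sup>+y. g y \<partial>\<pi>) = (\<integral>\<^sup>+y. 1 / ennreal (r y) / ennreal mean_holding * g y \<partial>\<pi>\<^sub>0)"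
  unfolding ctmc_invariant_def Let_def ennreal_mean_holding[symmetric]
  by (rule nn_integral_density) (simp_all add: measurable_cong_sets[OF sets_\<pi>\<^sub>0 refl])

lemma prob_\<pi>: "prob_space \<pi>"
proof
  have "emeasure \<pi> (space \<pi>) = (\<integral>\<^sup>+y. 1 / ennreal (r y) / ennreal mean_holding \<partial>\<pi>\<^sub>0)"
    using nn_integral_\<pi>[of "\<lambda>_. 1"] by simp
  also have "\<dots> = ennreal mean_holding / ennreal mean_holding"
    unfolding ennreal_mean_holding
    by (rule nn_integral_divide) (simp add: measurable_cong_sets[OF sets_\<pi>\<^sub>0 refl])
  finally show "emeasure \<pi> (space \<pi>) = 1"
    using mean_holding_pos by (simp add: divide_ennreal)
qed

lemma integral_centered_\<pi>:
  fixes f :: "'a \<Rightarrow> real"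
  assumes "f \<in> borel_measurable borel" and f_bounded: "\<And>y. \<bar>f y\<bar> \<le> G"
  shows "(\<integral>y. f y - (\<integral>y. f y \<partial>\<pi>) \<partial>\<pi>) = 0"
proof -
  interpret \<pi>: prob_space \<pi> by (rule prob_\<pi>)
  have "integrable \<pi> f"
    by (rule \<pi>.integrable_const_bound[where B=G])
      (use assms in \<open>auto simp: measurable_cong_sets[OF sets_\<pi> refl]\<close>)
  then show ?thesis by (simp add: \<pi>.prob_space)
qed

lemma \<pi>_eq_size_biased: "\<pi> = distr (density \<Theta> (\<lambda>z. ennreal (enn2real (snd z) / mean_holding))) borel fst"
proof (rule measure_eqI)
  fix A assume "A \<in> sets \<pi>"
  then have A_sets[measurable]: "A \<in> sets borel" by (simp add: sets_\<pi>)
  have finite: "AE z in \<Theta>. snd z \<noteq> \<infinity>"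
    by (rule nn_integral_PInf_AE)
      (simp_all add: nn_integral_holding_time[OF sets_\<pi>\<^sub>0] flip: ennreal_mean_holding)
  have "emeasure (distr (density \<Theta> (\<lambda>z. ennreal (enn2real (snd z) / mean_holding))) borel fst) A
      = (\<integral>\<^sup>+z. ennreal (enn2real (snd z) / mean_holding) * indicator A (fst z) \<partial>\<Theta>)"
    by (subst nn_integral_indicator[symmetric], simp, subst nn_integral_distr, measurable)
      (subst nn_integral_density, auto)
  also have "\<dots> = (\<integral>\<^sup>+z. snd z / ennreal mean_holding * indicator A (fst z) \<partial>\<Theta>)"
    using finite mean_holding_pos
    by (intro nn_integral_cong_AE) (auto simp: less_top divide_ennreal[symmetric] elim!: eventually_mono)
  also have "\<dots> = (\<integral>\<^sup>+y. \<integral>\<^sup>+s. s * (indicator A y / ennreal mean_holding) \<partial>holding_law (r y) \<partial>\<pi>\<^sub>0)"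
    by (subst nn_integral_with_holding[OF sets_\<pi>\<^sub>0]) (simp_all add: divide_ennreal_def mult_ac)
  also have "\<dots> = (\<integral>\<^sup>+y. 1 / ennreal (r y) / ennreal mean_holding * indicator A y \<partial>\<pi>\<^sub>0)"
    by (simp add: nn_integral_multc nn_integral_holding_law nn divide_ennreal_def mult_ac)
  also have "\<dots> = emeasure \<pi> A"
    using nn_integral_\<pi>[of "indicator A"] by (simp add: sets_\<pi>)
  finally show "emeasure \<pi> A
      = emeasure (distr (density \<Theta> (\<lambda>z. ennreal (enn2real (snd z) / mean_holding))) borel fst) A"
    by simp
qed (simp add: sets_\<pi>)

lemma integral_sojourn_reward_\<Theta>:
  assumes [measurable]: "g \<in> borel_measurable borel"
  shows "(\<integral>z. sojourn_reward g z \<partial>\<Theta>) = mean_holding * (\<integral>y. g y \<partial>\<pi>)"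
proof -
  have "(\<integral>y. g y \<partial>\<pi>) = (\<integral>z. enn2real (snd z) / mean_holding * g (fst z) \<partial>\<Theta>)"
    using mean_holding_pos by (subst \<pi>_eq_size_biased, subst integral_distr)
      (auto simp: integral_density)
  then show ?thesis using mean_holding_pos by (simp add: sojourn_reward_def mult.commute)
qed

lemma integrable_sojourn_reward_\<Lambda>:
  assumes "g \<in> borel_measurable borel" "\<And>y. \<bar>g y\<bar> \<le> G"
  shows "integrable \<Lambda> (sojourn_reward g)"
proof -
  have "(\<integral>\<^sup>+y. 1 / ennreal (r y) \<partial>lam) = ennreal (enn2real (\<integral>\<^sup>+y. 1 / ennreal (r y) \<partial>lam))"
    using inv_r by simp
  from integrable_sojourn_reward[OF base.prob_\<nu> base.sets_\<nu> this _ assms] show ?thesis by simp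
qed

lemma dominated_doeblin_chain_skeleton:
  "dominated_doeblin_chain (borel \<Otimes>\<^sub>M borel) pair_kernel \<Lambda> c C (skeleton_law r K x) (\<lambda>n w. w n)"
  using pair.dominated_doeblin_kernel_axioms markov_chain_skeleton
  by (rule dominated_doeblin_chain.intro)

lemma integrable_reward:
  assumes g: "g \<in> borel_measurable borel" "\<And>y. \<bar>g y\<bar> \<le> G" and rate_pos: "0 < r x"
  shows "integrable (skeleton_law r K x) (reward g n)"
proof -
  interpret dominated_doeblin_chain "borel \<Otimes>\<^sub>M borel" pair_kernel \<Lambda> c C "skeleton_law r K x" "\<lambda>n w. w n"
    by (rule dominated_doeblin_chain_skeleton)
  show ?thesis
    unfolding reward_def[abs_def]
    by (intro Bochner_Integration.integrable_sum
        integrable_X[OF integrable_sojourn_reward_\<Lambda>[OF g] integrable_initial_reward[OF g rate_pos]])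
qed

definition mean_reward_deviation :: "('a \<Rightarrow> real) \<Rightarrow> nat \<Rightarrow> 'a \<Rightarrow> real" where
  "mean_reward_deviation g n x
    = (\<integral>w. \<bar>reward g n w / real n - mean_holding * (\<integral>y. g y \<partial>\<pi>)\<bar> \<partial>skeleton_law r K x)"

lemma mean_reward_deviation_uniform_limit:
  assumes g: "g \<in> borel_measurable borel" "\<And>y. \<bar>g y\<bar> \<le> G" and b_pos: "0 < b"
  shows "uniform_limit {x. b \<le> r x} (mean_reward_deviation g) (\<lambda>_. 0) sequentially"
  unfolding mean_reward_deviation_def[abs_def] integral_sojourn_reward_\<Theta>[OF g(1), symmetric] reward_def
proof (rule pair.uniform_mean_ergodic_theorem[where X="\<lambda>k w. w k" and \<phi>="sojourn_reward g"])
  show "markov_chain (borel \<Otimes>\<^sub>M borel) pair_kernel (skeleton_law r K x) (\<lambda>k w. w k)" for x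
    by (rule markov_chain_skeleton)
  show "pair.invariant \<Theta>" by (rule invariant_with_holding[OF invariant_\<pi>\<^sub>0])
  show "integrable \<Lambda> (sojourn_reward g)" by (rule integrable_sojourn_reward_\<Lambda>[OF g])
  fix x assume rate_ge: "x \<in> {x. b \<le> r x}"
  then have rate_pos: "0 < r x" using b_pos by simp
  show "integrable (skeleton_law r K x) (\<lambda>w. sojourn_reward g (w 0))"
    by (rule integrable_initial_reward[OF g rate_pos])
  have "(\<integral>w. \<bar>sojourn_reward g (w 0)\<bar> \<partial>skeleton_law r K x) \<le> G * (1 / r x)"
    by (rule integral_abs_initial_reward_le[OF g rate_pos])
  also have "\<dots> \<le> G * (1 / b)"
    using rate_ge b_pos g(2)[of x] by (intro mult_left_mono divide_left_mono) auto
  finally show "(\<integral>w. \<bar>sojourn_reward g (w 0)\<bar> \<partial>skeleton_law r K x) \<le> G * (1 / b)" .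
qed

lemma AE_holding_finite:
  assumes rate_pos: "0 < r x"
  shows "AE w in skeleton_law r K x. \<forall>k. snd (w k) \<noteq> \<infinity>"
proof (subst AE_all_countable, rule allI)
  interpret dominated_doeblin_chain "borel \<Otimes>\<^sub>M borel" pair_kernel \<Lambda> c C "skeleton_law r K x" "\<lambda>n w. w n"
    by (rule dominated_doeblin_chain_skeleton)
  fix k
  let ?L = "distr (skeleton_law r K x) (borel \<Otimes>\<^sub>M borel) (\<lambda>w. w k)"
  have "(\<integral>\<^sup>+z. snd z \<partial>?L) < \<infinity>"
  proof (cases k)
    case 0
    then show ?thesis
      using nn_integral_holding_time[of "return borel x"]
      by (simp add: distr_skeleton_initial nn_integral_inverse_rate_return[OF rate_pos])
  next
    case (Suc n)
    have "(\<integral>\<^sup>+z. snd z \<partial>?L) \<le> ennreal C * (\<integral>\<^sup>+z. snd z \<partial>\<Lambda>)"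
      unfolding Suc
      by (rule nn_integral_le_scale_measure[OF _ _ distr_Suc_dominated])
        (simp_all add: pair.sets_\<nu> measurable_cong_sets[OF sets_\<Lambda> refl])
    also have "\<dots> < \<infinity>"
      using inv_r by (simp add: nn_integral_holding_time[OF base.sets_\<nu>] ennreal_mult_less_top)
    finally show ?thesis .
  qed
  then have "AE z in ?L. snd z \<noteq> \<infinity>"
    by (intro nn_integral_PInf_AE) auto
  then show "AE w in skeleton_law r K x. snd (w k) \<noteq> \<infinity>"
    by (subst (asm) AE_distr_iff) auto
qed

end

section \<open>Jump times\<close>

lemma jump_time_eq_reward:
  assumes "\<And>k. snd (w k) \<noteq> \<infinity>"
  shows "jump_time w n = ennreal (reward (\<lambda>_. 1) n w)"
proof -
  have "snd (w k) = ennreal (enn2real (snd (w k)))" for k using assms[of k] by (simp add: less_top)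
  then have "jump_time w n = (\<Sum>k<n. ennreal (enn2real (snd (w k))))" by (simp add: jump_time_def)
  then show ?thesis by (simp add: reward_def sojourn_reward_def sum_ennreal)
qed

lemma SUP_jump_time_eq_infinity:
  assumes finite: "\<And>k. snd (w k) \<noteq> \<infinity>" and \<rho>: "strict_mono \<rho>" and m_pos: "0 < m"
    and lim: "(\<lambda>n. reward (\<lambda>_. 1) (\<rho> n) w / real (\<rho> n)) \<longlonglongrightarrow> m"
  shows "(SUP n. jump_time w n) = \<infinity>"
proof (rule ccontr)
  assume "(SUP n. jump_time w n) \<noteq> \<infinity>"
  then obtain R where SUP_eq: "(SUP n. jump_time w n) = ennreal R" "0 \<le> R"
    by (cases "SUP n. jump_time w n") auto
  have "jump_time w n \<le> ennreal R" for n unfolding SUP_eq(1)[symmetric] by (rule SUP_upper) simp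
  then have "reward (\<lambda>_. 1) n w \<le> R" for n
    using SUP_eq(2) by (simp add: jump_time_eq_reward[of w, OF finite])
  then have "reward (\<lambda>_. 1) (\<rho> n) w / real (\<rho> n) \<le> R / real (\<rho> n)" for n by (simp add: divide_right_mono)
  moreover have "(\<lambda>n. R / real (\<rho> n)) \<longlonglongrightarrow> 0"
    using LIMSEQ_subseq_LIMSEQ[OF lim_const_over_n \<rho>, of R] by (simp add: comp_def)
  ultimately have "m \<le> 0" using lim by (intro LIMSEQ_le[OF lim]) auto
  with m_pos show False by simp
qed

lemma (in ergodic_jump_kernel) AE_nonexplosive:
  assumes rate_pos: "0 < r x"
  shows "AE w in skeleton_law r K x. (SUP n. jump_time w n) = \<infinity>"
proof -
  let ?D = "\<lambda>n w. reward (\<lambda>_. 1) n w / real n - mean_holding"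
  interpret prob_space "skeleton_law r K x" by (rule prob_space_skeleton_law)
  have "(\<lambda>n. mean_reward_deviation (\<lambda>_. 1) n x) \<longlonglongrightarrow> 0"
    using tendsto_uniform_limitI[OF mean_reward_deviation_uniform_limit[of "\<lambda>_. 1" 1 "r x"], of x]
      rate_pos by simp
  then have "(\<lambda>n. \<integral>w. norm (?D n w) \<partial>skeleton_law r K x) \<longlonglongrightarrow> 0"
    by (simp add: mean_reward_deviation_def prob_space.prob_space[OF prob_\<pi>])
  moreover have "integrable (skeleton_law r K x) (?D n)" for n
    using integrable_reward[of "\<lambda>_. 1" 1, OF _ _ rate_pos] by auto
  ultimately obtain \<rho> where subsequence: "strict_mono \<rho>"
    "AE w in skeleton_law r K x. (\<lambda>n. ?D (\<rho> n) w) \<longlonglongrightarrow> 0"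
    using tendsto_L1_AE_subseq[of "skeleton_law r K x" ?D] by blast
  from subsequence(2) AE_holding_finite[OF rate_pos] show ?thesis
  proof eventually_elim
    case (elim w)
    then show ?case
      using SUP_jump_time_eq_infinity[of w, OF _ subsequence(1) mean_holding_pos LIM_zero_cancel] by blast
  qed
qed

section \<open>Time averages along the path\<close>

lemma set_integral_abs_le:
  fixes h :: "real \<Rightarrow> real"
  assumes integrable: "set_integrable lborel {a..<b} h" and "a \<le> b" and bounded: "\<And>t. \<bar>h t\<bar> \<le> B"
  shows "\<bar>LINT t:{a..<b}|lborel. h t\<bar> \<le> B * (b - a)"
proof -
  have "\<bar>LINT t:{a..<b}|lborel. h t\<bar> \<le> (LINT t:{a..<b}|lborel. \<bar>h t\<bar>)"
    using set_integral_norm_bound[OF integrable] by simp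
  also have "\<dots> \<le> (LINT t:{a..<b}|lborel. B)"
    using set_integrable_abs[OF integrable] bounded \<open>a \<le> b\<close> by (intro set_integral_mono)
      (auto simp: set_integrable_def)
  also have "\<dots> = B * (b - a)"
    using \<open>a \<le> b\<close> by (simp add: set_lebesgue_integral_def)
  finally show ?thesis .
qed

lemma set_integral_abs_diff_le:
  fixes h :: "real \<Rightarrow> real"
  assumes integrable: "\<And>b. set_integrable lborel {0..<b} h"
    and bounded: "\<And>t. \<bar>h t\<bar> \<le> B" and "0 \<le> s" "0 \<le> t"
  shows "\<bar>(LINT u:{0..<s}|lborel. h u) - (LINT u:{0..<t}|lborel. h u)\<bar> \<le> B * \<bar>s - t\<bar>"
  using \<open>0 \<le> s\<close> \<open>0 \<le> t\<close>
proof (induction s t rule: linorder_wlog)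
  case (le s t)
  have integrable_diff: "set_integrable lborel {s..<t} h"
    by (rule set_integrable_subset[OF integrable[of t]]) (use le in auto)
  have "{0..<t} = {0..<s} \<union> {s..<t}" using le by auto
  then have "(LINT u:{0..<t}|lborel. h u) = (LINT u:{0..<s}|lborel. h u) + (LINT u:{s..<t}|lborel. h u)"
    using set_integral_Un[OF _ integrable integrable_diff, of s] by simp
  then show ?case using set_integral_abs_le[OF integrable_diff _ bounded] le by simp
qed (simp add: abs_minus_commute)

locale nonexplosive_skeleton =
  fixes w :: "nat \<Rightarrow> 'a::topological_space \<times> ennreal"
  assumes finite: "\<And>k. snd (w k) \<noteq> \<infinity>"
    and nonexplosive: "(SUP n. jump_time w n) = \<infinity>"
begin

abbreviation arrival_time :: "nat \<Rightarrow> real" where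
  "arrival_time n \<equiv> reward (\<lambda>_. 1) n w"

lemma arrival_time_nonneg: "0 \<le> arrival_time n"
  by (simp add: reward_def sojourn_reward_def sum_nonneg)

lemma path_eq: "arrival_time n \<le> t \<Longrightarrow> t < arrival_time (Suc n) \<Longrightarrow> skeleton_path w t = fst (w n)"
  using arrival_time_nonneg[of n]
  by (intro skeleton_path_eq nonexplosive)
    (auto simp: jump_time_eq_reward[of w, OF finite] ennreal_leI ennreal_less_iff)

lemma path_integrable:
  assumes h_bounded: "\<And>y. \<bar>h y :: real\<bar> \<le> B"
  shows "set_integrable lborel {0..<t} (\<lambda>u. h (skeleton_path w u))"
  unfolding set_integrable_def
proof (rule Bochner_Integration.integrable_bound[where f="\<lambda>u. B * indicator {0..<t} u"])
  let ?index = "\<lambda>u. LEAST n. ennreal u < jump_time w (Suc n)"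
  have "?index \<in> borel \<rightarrow>\<^sub>M count_space UNIV" by measurable
  then have "(\<lambda>u. h (fst (w (?index u)))) \<in> borel_measurable borel"
    by (rule measurable_compose) measurable
  then have "(\<lambda>u. indicator {0..<t} u *\<^sub>R h (fst (w (?index u)))) \<in> borel_measurable borel"
    by simp
  also have "(\<lambda>u. indicator {0..<t} u *\<^sub>R h (fst (w (?index u))))
     = (\<lambda>u. indicator {0..<t} u *\<^sub>R h (skeleton_path w u))"
    using nonexplosive by (auto simp: skeleton_path_def indicator_def fun_eq_iff)
  finally show "(\<lambda>u. indicator {0..<t} u *\<^sub>R h (skeleton_path w u)) \<in> borel_measurable lborel" by simp
  show "AE u in lborel. norm (indicator {0..<t} u *\<^sub>R h (skeleton_path w u))
      \<le> norm (B * indicator {0..<t} u)"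
    using h_bounded by (auto simp: indicator_def intro: order_trans[OF _ abs_ge_self])
qed (auto intro!: integrable_mult_right emeasure_bounded_finite)

lemma integral_to_arrival_time:
  assumes h_bounded: "\<And>y. \<bar>h y\<bar> \<le> B"
  shows "(LINT u:{0..<arrival_time n}|lborel. h (skeleton_path w u)) = reward h n w"
proof (induction n)
  case 0 show ?case by (simp add: reward_def set_lebesgue_integral_def)
next
  case (Suc n)
  have mono: "arrival_time n \<le> arrival_time (Suc n)" by (simp add: reward_def sojourn_reward_def)
  have sojourn: "{0..<arrival_time (Suc n)}
      = {0..<arrival_time n} \<union> {arrival_time n..<arrival_time (Suc n)}"
    using arrival_time_nonneg[of n] mono by auto
  have "(LINT u:{arrival_time n..<arrival_time (Suc n)}|lborel. h (skeleton_path w u))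
      = (LINT u:{arrival_time n..<arrival_time (Suc n)}|lborel. h (fst (w n)))"
    by (rule set_lebesgue_integral_cong) (auto simp: path_eq)
  also have "\<dots> = h (fst (w n)) * enn2real (snd (w n))"
    using mono by (simp add: set_lebesgue_integral_def reward_def sojourn_reward_def)
  finally have "(LINT u:{arrival_time n..<arrival_time (Suc n)}|lborel. h (skeleton_path w u))
      = h (fst (w n)) * enn2real (snd (w n))" .
  moreover have "set_integrable lborel {arrival_time n..<arrival_time (Suc n)}
      (\<lambda>u. h (skeleton_path w u))"
    by (rule set_integrable_subset[OF path_integrable[OF h_bounded]]) (use arrival_time_nonneg in auto)
  ultimately show ?case
    using Suc unfolding sojourn by (subst set_integral_Un[OF _ path_integrable[OF h_bounded]])
      (auto simp: reward_def sojourn_reward_def)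
qed

lemma time_average_deviation_le:
  assumes f_close: "\<And>y. \<bar>f y - a\<bar> \<le> B" and t_pos: "0 < t"
  shows "\<bar>time_average f t (skeleton_path w) - a\<bar>
      \<le> (\<bar>reward (\<lambda>y. f y - a) n w\<bar> + B * \<bar>t - arrival_time n\<bar>) / t"
proof -
  let ?h = "\<lambda>u. f (skeleton_path w u) - a"
  have h_integrable: "set_integrable lborel {0..<b} ?h" for b using path_integrable[OF f_close] .
  have "(LINT u:{0..t}|lborel. f (skeleton_path w u)) = (LINT u:{0..<t}|lborel. f (skeleton_path w u))"
    by (rule set_integral_discrete_difference[where X="{t}"]) auto
  also have "\<dots> = (LINT u:{0..<t}|lborel. ?h u + a)" by simp
  also have "\<dots> = (LINT u:{0..<t}|lborel. ?h u) + a * t"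
    using t_pos by (subst set_integral_add(2)[OF h_integrable])
      (auto simp: set_integrable_def set_lebesgue_integral_def)
  finally have average: "time_average f t (skeleton_path w) - a = (LINT u:{0..<t}|lborel. ?h u) / t"
    using t_pos by (simp add: time_average_def field_simps)
  have "\<bar>LINT u:{0..<t}|lborel. ?h u\<bar> \<le> \<bar>reward (\<lambda>y. f y - a) n w\<bar> + B * \<bar>t - arrival_time n\<bar>"
    using set_integral_abs_diff_le[OF h_integrable f_close, of t "arrival_time n"] t_pos
      arrival_time_nonneg[of n]
      integral_to_arrival_time[of "\<lambda>y. f y - a", OF f_close, of n] by linarith
  then show ?thesis using t_pos by (simp add: average divide_right_mono)
qed

lemma time_average_deviation_le_mean_rewards:
  fixes m t :: real
  assumes f_close: "\<And>y. \<bar>f y - a\<bar> \<le> B" and t_pos: "0 < t" and m_pos: "0 < m"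
  defines "n \<equiv> nat \<lfloor>t / m\<rfloor>"
  shows "\<bar>time_average f t (skeleton_path w) - a\<bar>
    \<le> (\<bar>reward (\<lambda>y. f y - a) n w / n\<bar> + B * \<bar>arrival_time n / n - m\<bar>) / m + B * m / t"
proof -
  let ?D = "\<bar>reward (\<lambda>y. f y - a) n w / n\<bar> + B * \<bar>arrival_time n / n - m\<bar>"
  have B_nonneg: "0 \<le> B" using f_close order_trans[OF abs_ge_zero] by blast
  have "real n \<le> t / m" "t / m < n + 1" using t_pos m_pos by (simp_all add: n_def) linarith
  then have n_bracket: "n * m \<le> t" "t < n * m + m" using m_pos by (auto simp: field_simps)
  have reward_eq: "\<bar>reward g n w - n * b\<bar> = n * \<bar>reward g n w / n - b\<bar>" for g and b :: real
  proof -
    have "reward g n w - n * b = n * (reward g n w / n - b)"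
      by (cases "n = 0") (simp_all add: reward_def right_diff_distrib)
    then show ?thesis by (simp only: abs_mult abs_of_nat)
  qed
  have "\<bar>t - arrival_time n\<bar> \<le> n * \<bar>arrival_time n / n - m\<bar> + m"
    unfolding reward_eq[symmetric] using n_bracket by linarith
  then have "B * \<bar>t - arrival_time n\<bar> \<le> B * (n * \<bar>arrival_time n / n - m\<bar> + m)"
    using B_nonneg by (rule mult_left_mono)
  then have "\<bar>reward (\<lambda>y. f y - a) n w\<bar> + B * \<bar>t - arrival_time n\<bar> \<le> ?D * n + B * m"
    using reward_eq[of "\<lambda>y. f y - a" 0] by (simp add: algebra_simps)
  then have "\<bar>time_average f t (skeleton_path w) - a\<bar> \<le> (?D * n + B * m) / t"
    using t_pos
    by (intro order_trans[OF time_average_deviation_le[where n=n, OF f_close t_pos]] divide_right_mono) auto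
  also have "\<dots> = ?D * (n / t) + B * m / t" by (simp add: add_divide_distrib)
  also have "\<dots> \<le> ?D * (1 / m) + B * m / t"
    using n_bracket(1) t_pos m_pos B_nonneg by (intro add_right_mono mult_left_mono)
      (auto simp: field_simps)
  finally show ?thesis by simp
qed

end

context ergodic_jump_kernel begin

lemma measure_ctmc_law_le:
  assumes event_imp: "AE w in skeleton_law r K x. skeleton_path w \<in> E \<longrightarrow> w \<in> A"
    and A_sets: "A \<in> sets (skeleton_law r K x)"
  shows "measure (ctmc_law r K x) E \<le> measure (skeleton_law r K x) A"
proof (cases "E \<in> sets skorokhod_space")
  case True
  interpret prob_space "skeleton_law r K x" by (rule prob_space_skeleton_law)
  have "measure (ctmc_law r K x) E
      = measure (skeleton_law r K x) (skeleton_path -` E \<inter> space (skeleton_law r K x))"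
    unfolding ctmc_law_def by (rule measure_distr[OF skeleton_path_measurable True])
  also have "\<dots> \<le> measure (skeleton_law r K x) A"
    using event_imp A_sets by (intro finite_measure_mono_AE) auto
  finally show ?thesis .
next
  case False
  \<comment> \<open>Sets outside the \<open>\<sigma>\<close>-algebra have measure zero, so measurability of \<open>E\<close> is not needed.\<close>
  then show ?thesis by (simp add: ctmc_law_def measure_notin_sets)
qed

abbreviation "deviation_event f \<epsilon> t x \<equiv>
  {w \<in> space (ctmc_law r K x). \<bar>time_average f t w - (\<integral>y. f y \<partial>\<pi>)\<bar> > \<epsilon>}"

lemma measure_deviation_event_le:
  assumes f: "f \<in> borel_measurable borel" "\<And>y. \<bar>f y\<bar> \<le> G" and f_close: "\<And>y. \<bar>f y - (\<integral>y. f y \<partial>\<pi>)\<bar> \<le> B"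
    and rate_pos: "0 < r x" and t_pos: "0 < t" and \<epsilon>_pos: "0 < \<epsilon>"
  defines "h \<equiv> \<lambda>y. f y - (\<integral>y. f y \<partial>\<pi>)" and "n \<equiv> nat \<lfloor>t / mean_holding\<rfloor>"
  shows "measure (ctmc_law r K x) (deviation_event f \<epsilon> t x)
    \<le> ((mean_reward_deviation h n x + B * mean_reward_deviation (\<lambda>_. 1) n x) / mean_holding
        + B * mean_holding / t) / \<epsilon>"
proof -
  let ?D = "\<lambda>w. (\<bar>reward h n w / n\<bar> + B * \<bar>reward (\<lambda>_. 1) n w / n - mean_holding\<bar>) / mean_holding
    + B * mean_holding / t"
  interpret P: prob_space "skeleton_law r K x" by (rule prob_space_skeleton_law)
  have B_nonneg: "0 \<le> B" using f_close order_trans[OF abs_ge_zero] by blast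
  have h: "h \<in> borel_measurable borel" "\<And>y. \<bar>h y\<bar> \<le> B" using f f_close by (simp_all add: h_def)
  have rewards: "integrable (skeleton_law r K x) (reward h n)"
    "integrable (skeleton_law r K x) (reward (\<lambda>_. 1) n)"
    by (rule integrable_reward[OF h rate_pos], rule integrable_reward[of _ 1, OF _ _ rate_pos]) auto
  then have D_integrable: "integrable (skeleton_law r K x) ?D" by simp
  have "AE w in skeleton_law r K x. skeleton_path w \<in> deviation_event f \<epsilon> t x
      \<longrightarrow> w \<in> {w \<in> space (skeleton_law r K x). \<epsilon> \<le> ?D w}"
    using AE_holding_finite[OF rate_pos] AE_nonexplosive[OF rate_pos]
  proof eventually_elim
    case (elim w)
    interpret nonexplosive_skeleton w using elim by unfold_locales auto
    show ?case
      using time_average_deviation_le_mean_rewards[of f, OF f_close t_pos mean_holding_pos]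
      by (auto simp: h_def n_def space_skeleton_law)
  qed
  then have "measure (ctmc_law r K x) (deviation_event f \<epsilon> t x)
      \<le> P.prob {w \<in> space (skeleton_law r K x). \<epsilon> \<le> ?D w}"
    using D_integrable by (intro measure_ctmc_law_le) auto
  also have "\<dots> \<le> P.expectation ?D / \<epsilon>"
    using mean_holding_pos t_pos B_nonneg \<epsilon>_pos
    by (intro integral_Markov_inequality_measure[OF D_integrable sets.empty_sets]) auto
  also have "P.expectation ?D
      = (mean_reward_deviation h n x + B * mean_reward_deviation (\<lambda>_. 1) n x) / mean_holding
      + B * mean_holding / t"
    using rewards integral_centered_\<pi>[OF f]
    by (simp add: mean_reward_deviation_def h_def prob_space.prob_space[OF prob_\<pi>] P.prob_space)
  finally show ?thesis .
qed

theorem measure_deviation_event_uniform_limit: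
  assumes f: "f \<in> borel_measurable borel" "\<And>y. \<bar>f y\<bar> \<le> G" and b_pos: "0 < b" and \<epsilon>_pos: "0 < \<epsilon>"
  shows "uniform_limit {x. b \<le> r x} (\<lambda>t x. measure (ctmc_law r K x) (deviation_event f \<epsilon> t x))
    (\<lambda>_. 0) at_top"
proof (rule uniform_limit_null_comparison)
  define h where "h y = f y - (\<integral>y. f y \<partial>\<pi>)" for y
  define B where "B = G + \<bar>\<integral>y. f y \<partial>\<pi>\<bar>"
  let ?n = "\<lambda>t. nat \<lfloor>t / mean_holding\<rfloor>"
  let ?bound = "\<lambda>t x. ((mean_reward_deviation h (?n t) x
        + B * mean_reward_deviation (\<lambda>_. 1) (?n t) x) / mean_holding
        + B * mean_holding / t) / \<epsilon>"
  have h: "h \<in> borel_measurable borel" "\<bar>h y\<bar> \<le> B" for y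
    using f(1) abs_triangle_ineq4[of "f y" "\<integral>y. f y \<partial>\<pi>"] f(2)[of y]
    by (simp_all add: h_def[abs_def] B_def)
  show "\<forall>\<^sub>F t in at_top. \<forall>x\<in>{x. b \<le> r x}.
      norm (measure (ctmc_law r K x) (deviation_event f \<epsilon> t x)) \<le> ?bound t x"
    using eventually_gt_at_top[of 0]
  proof eventually_elim
    case (elim t)
    then show ?case
      using measure_deviation_event_le[OF f h(2)[unfolded h_def] _ elim \<epsilon>_pos] b_pos
      by (auto simp flip: h_def)
  qed
  have "LIM t at_top. t / mean_holding :> at_top"
    unfolding divide_inverse using mean_holding_pos
    by (intro filterlim_at_top_mult_tendsto_pos[OF tendsto_const _ filterlim_ident]) simp
  then have "filterlim ?n sequentially at_top"
    by (intro filterlim_compose[OF filterlim_nat_sequentially]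
        filterlim_compose[OF filterlim_floor_sequentially])
  then have deviation_limit:
    "uniform_limit {x. b \<le> r x} (\<lambda>t. mean_reward_deviation g (?n t)) (\<lambda>_. 0) at_top"
    if "g \<in> borel_measurable borel" "\<And>y. \<bar>g y\<bar> \<le> G'" for g G'
    by (rule filterlim_compose[OF mean_reward_deviation_uniform_limit[OF that b_pos]])
  have "((\<lambda>t. B * mean_holding / t) \<longlongrightarrow> 0) at_top"
    by (rule tendsto_divide_0[OF tendsto_const filterlim_at_top_imp_at_infinity[OF filterlim_ident]])
  then have "uniform_limit {x. b \<le> r x} (\<lambda>t x. B * mean_holding / t) (\<lambda>_. 0) at_top"
    by (auto intro!: uniform_limitI dest: tendstoD)
  then have "uniform_limit {x. b \<le> r x} ?bound (\<lambda>_. ((0 + B * 0) / mean_holding + 0) / \<epsilon>) at_top"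
    by (intro uniform_limit_intros deviation_limit[OF h] deviation_limit[of "\<lambda>_. 1" 1]) auto
  then show "uniform_limit {x. b \<le> r x} ?bound (\<lambda>_. 0) at_top" by simp
qed

end

section \<open>Convergence to the invariant measure\<close>

lemma tendsto_SUP_ennreal:
  assumes "uniform_limit S f (\<lambda>_. 0) F"
  shows "((\<lambda>t. SUP x\<in>S. ennreal (f t x)) \<longlongrightarrow> 0) F"
proof (rule order_tendstoI)
  fix a :: ennreal assume "0 < a"
  then obtain e where e_between: "0 < e" "e < a" using dense by blast
  then have "e \<noteq> top" by auto
  then obtain \<epsilon> where e_eq: "e = ennreal \<epsilon>" "0 < \<epsilon>" using e_between(1) by (cases e) auto
  have "\<forall>\<^sub>F t in F. \<forall>x\<in>S. dist (f t x) 0 < \<epsilon>" by (rule uniform_limitD[OF assms e_eq(2)])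
  then show "\<forall>\<^sub>F t in F. (SUP x\<in>S. ennreal (f t x)) < a"
  proof eventually_elim
    case (elim t)
    then have "(SUP x\<in>S. ennreal (f t x)) \<le> e"
      unfolding e_eq(1) by (intro SUP_least ennreal_leI) (force simp: dist_real_def)
    then show ?case using e_between(2) by (rule le_less_trans)
  qed
qed simp

lemma compact_positive_lower_bound:
  fixes f :: "'a::topological_space \<Rightarrow> real"
  assumes "compact S" "continuous_on S f" "\<And>x. x \<in> S \<Longrightarrow> 0 < f x"
  obtains b where "0 < b" "\<And>x. x \<in> S \<Longrightarrow> b \<le> f x"
proof (cases "S = {}")
  case False
  then obtain y where "y \<in> S" "\<And>x. x \<in> S \<Longrightarrow> f y \<le> f x"
    using continuous_attains_inf[OF assms(1) _ assms(2)] by auto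
  then show thesis using that[of "f y"] assms(3) by auto
qed (use that[of 1] in auto)

lemma
  assumes [measurable]: "g \<in> borel_measurable M"
  shows scale_measure_le_density: "(\<And>x. x \<in> space M \<Longrightarrow> a \<le> g x) \<Longrightarrow> scale_measure a M \<le> density M g"
    and density_le_scale_measure: "(\<And>x. x \<in> space M \<Longrightarrow> g x \<le> a) \<Longrightarrow> density M g \<le> scale_measure a M"
  by (auto intro!: le_measure[THEN iffD2, OF _ ballI] nn_integral_mono mult_right_mono
      simp: emeasure_density nn_integral_cmult_indicator[symmetric])

lemma ergodic_jump_kernel_density:
  fixes r :: "'a::polish_space \<Rightarrow> real" and p :: "'a \<Rightarrow> 'a \<Rightarrow> real"
  assumes rate: "r \<in> borel_measurable borel" "\<And>x. 0 \<le> r x"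
    and kernel: "K \<in> borel \<rightarrow>\<^sub>M prob_algebra borel" "\<And>x. K x = density lam (\<lambda>y. ennreal (p x y))"
    and lam: "prob_space lam" "sets lam = sets borel" "(\<integral>\<^sup>+x. 1 / ennreal (r x) \<partial>lam) < \<infinity>"
    and density: "\<And>x. p x \<in> borel_measurable borel" "0 < c" "\<And>x y. c \<le> p x y" "\<And>x y. p x y \<le> C"
  shows "ergodic_jump_kernel r K lam c C"
proof -
  have p_lam: "(\<lambda>y. ennreal (p x y)) \<in> borel_measurable lam" for x
    using density(1)[of x] by (simp add: measurable_cong_sets[OF lam(2) refl])
  have "scale_measure (ennreal c) lam \<le> K x" "K x \<le> scale_measure (ennreal C) lam" for x
    unfolding kernel(2) using density
    by (auto intro!: scale_measure_le_density[OF p_lam] density_le_scale_measure[OF p_lam] ennreal_leI)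
  then show ?thesis
    using rate kernel(1) lam density(2)
    by (intro ergodic_jump_kernel.intro jump_kernel.intro dominated_doeblin_kernel.intro doeblin_kernel.intro
        markov_kernel.intro doeblin_kernel_axioms.intro dominated_doeblin_kernel_axioms.intro
        ergodic_jump_kernel_axioms.intro) auto
qed

lemma continuous_density_bounds:
  fixes p :: "'a::topological_space \<Rightarrow> 'a \<Rightarrow> real"
  assumes compact_E: "compact (UNIV :: 'a set)"
    and density: "continuous_on UNIV (\<lambda>(x, y). p x y)" "\<And>x y. 0 < p x y"
  obtains c C where "0 < c" "\<And>x y. c \<le> p x y" "\<And>x y. p x y \<le> C"
proof -
  have compact_E_times_E: "compact (UNIV :: ('a \<times> 'a) set)"
    using compact_Times[OF compact_E compact_E] by simp
  obtain c where "0 < c" "\<And>z. c \<le> (\<lambda>(x, y). p x y) z"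
    using compact_positive_lower_bound[OF compact_E_times_E density(1)] density(2) by auto
  moreover obtain C where "\<And>z. \<bar>(\<lambda>(x, y). p x y) z\<bar> \<le> C"
    using compact_imp_bounded[OF compact_continuous_image[OF density(1) compact_E_times_E]]
    by (auto simp: bounded_iff)
  ultimately show thesis using that[of c C] by (force simp: abs_le_iff)
qed

lemma (in ergodic_jump_kernel) SUP_emeasure_deviation_event_tendsto_0:
  assumes E1: "compact E1" "E1 \<subseteq> - {x. r x = 0}" and r_cont: "continuous_on UNIV r"
    and f: "f \<in> borel_measurable borel" "\<And>y. \<bar>f y\<bar> \<le> G" and \<epsilon>_pos: "0 < \<epsilon>"
  shows "((\<lambda>T. SUP x\<in>E1. emeasure (ctmc_law r K x) (deviation_event f \<epsilon> T x)) \<longlongrightarrow> 0) at_top"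
proof -
  obtain b where rate_ge: "0 < b" "\<And>x. x \<in> E1 \<Longrightarrow> b \<le> r x"
    using compact_positive_lower_bound[OF E1(1) continuous_on_subset[OF r_cont]] E1(2) nn
    by (auto simp: less_le)
  have "finite_measure (ctmc_law r K x)" for x
    by (rule prob_space.finite_measure[OF prob_space_ctmc_law])
  then show ?thesis
    using rate_ge(2) tendsto_SUP_ennreal[OF uniform_limit_on_subset[of _ _ _ _ E1,
          OF measure_deviation_event_uniform_limit[OF f rate_ge(1) \<epsilon>_pos]]]
    by (simp add: finite_measure.emeasure_eq_measure subset_iff)
qed

theorem theorem2p2:
  fixes r :: "'a::polish_space \<Rightarrow> real"
    and K :: "'a \<Rightarrow> 'a measure"
    and lam :: "'a measure"
    and p :: "'a \<Rightarrow> 'a \<Rightarrow> real"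
    and \<delta> :: "nat \<Rightarrow> real"
    and f :: "'a \<Rightarrow> real"
  assumes compact_E: "compact (UNIV :: 'a set)"
    and r_nonneg: "\<And>x. 0 \<le> r x"
    and r_cont: "continuous_on UNIV r"
    and kernel: "K \<in> borel \<rightarrow>\<^sub>M prob_algebra borel"
    and lam_prob: "prob_space lam" "sets lam = sets borel"
    and lam_pos: "\<And>U. open U \<Longrightarrow> U \<noteq> {} \<Longrightarrow> 0 < emeasure lam U"
    and p_cont: "continuous_on UNIV (\<lambda>(x, y). p x y)"
    and p_pos: "\<And>x y. 0 < p x y"
    and K_density: "\<And>x. K x = density lam (\<lambda>y. ennreal (p x y))"
    and inv_r_integrable: "(\<integral>\<^sup>+x. 1 / ennreal (r x) \<partial>lam) < \<infinity>"
    and \<delta>_pos: "\<And>n. 0 < \<delta> n"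
    and \<delta>_lim: "\<delta> \<longlonglongrightarrow> 0"
    and \<delta>_ratio: "(SUP n. emeasure lam (slow_set r (2 * \<delta> n)) /
        emeasure lam (slow_set r (2 * \<delta> n) - slow_set r (\<delta> n))) < \<infinity>"
    and f_cont: "continuous_on UNIV f"
  shows "(\<forall>x \<in> - {x. r x = 0}. \<forall>\<epsilon>>0.
           ((\<lambda>T. emeasure (ctmc_law r K x)
               {w \<in> space (ctmc_law r K x).
                  \<bar>time_average f T w - (\<integral>y. f y \<partial>ctmc_invariant r K)\<bar> > \<epsilon>})
            \<longlongrightarrow> 0) at_top)
       \<and> (\<forall>E1. compact E1 \<longrightarrow> E1 \<subseteq> - {x. r x = 0} \<longrightarrow> (\<forall>\<epsilon>>0.
           ((\<lambda>T. SUP x\<in>E1. emeasure (ctmc_law r K x)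
               {w \<in> space (ctmc_law r K x).
                  \<bar>time_average f T w - (\<integral>y. f y \<partial>ctmc_invariant r K)\<bar> > \<epsilon>})
            \<longlongrightarrow> 0) at_top))"
proof -
  obtain c C where p_bounds: "0 < c" "\<And>x y. c \<le> p x y" "\<And>x y. p x y \<le> C"
    using continuous_density_bounds[OF compact_E p_cont p_pos] by blast
  obtain G where f_bounded: "\<And>y. \<bar>f y\<bar> \<le> G"
    using compact_imp_bounded[OF compact_continuous_image[OF f_cont compact_E]]
    by (auto simp: bounded_iff)
  have measurable: "r \<in> borel_measurable borel" "f \<in> borel_measurable borel"
    using r_cont f_cont by (auto intro: borel_measurable_continuous_onI)
  have "continuous_on UNIV (Pair x :: 'a \<Rightarrow> 'a \<times> 'a)" for x
    by (rule continuous_on_Pair[OF continuous_on_const continuous_on_id])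
  then have "p x \<in> borel_measurable borel" for x
    using continuous_on_compose2[OF p_cont, of UNIV "Pair x"]
    by (simp add: borel_measurable_continuous_onI)
  then interpret ergodic_jump_kernel r K lam c C
    by (intro ergodic_jump_kernel_density[where p=p] measurable r_nonneg kernel K_density
        lam_prob inv_r_integrable p_bounds)
  note uniform = SUP_emeasure_deviation_event_tendsto_0[OF _ _ r_cont measurable(2) f_bounded]
  then show ?thesis
    using uniform[of "{x}" for x] by auto
qed

end
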